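(* Let $n\in\mathbb N$ and regard $L_n^{(0)}$ as an $\Re$-module via $\sharp$. Then: (i) if $n$ is odd, $L_n^{(0)}$ is isomorphic to the irreducible $\Re$-module $R_{\frac{n-1}{2}}(-\frac14,-\frac14,-\frac14)$; (ii) if $n=0$, $L_n^{(0)}$ is isomorphic to the irreducible $\Re$-module $R_0(-\frac12,-\frac12,-\frac12)$; (iii) if $n\neq0$ and $n\equiv0\pmod 4$, $L_n^{(0)}$ is isomorphic to the direct sum of the irreducible $\Re$-modules $R_{\frac n4-1}(\frac{n-4}{8},\frac n8,\frac{n-4}{8})$ and $R_{\frac n4}(\frac{n-4}{8},\frac{n-4}{8},\frac{n-4}{8})$; (iv) if $n\equiv2\pmod 4$, $L_n^{(0)}$ is isomorphic to the direct sum of the irreducible $\Re$-modules $R_{\frac{n-2}{4}}(\frac{n-6}{8},\frac{n-2}{8},\frac{n-2}{8})$ and $R_{\frac{n-2}{4}}(\frac{n-2}{8},\frac{n-2}{8},\frac{n-6}{8})$.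
   Context: $U(\mathfrak{sl}_2)$ is the $\mathbb C$-algebra generated by $E,F,H$ with $[H,E]=2E$, $[H,F]=-2F$, $[E,F]=H$. For $n\in\mathbb N$, $L_n$ is the $(n+1)$-dimensional $U(\mathfrak{sl}_2)$-module with basis $v_0,\dots,v_n$ such that $Ev_i=(n-i+1)v_{i-1}$ ($1\le i\le n$), $Ev_0=0$, $Fv_i=(i+1)v_{i+1}$ ($0\le i\le n-1$), $Fv_n=0$, $Hv_i=(n-2i)v_i$. Let $L_n^{(0)}=\mathrm{span}\{v_i: i \text{ even}\}$ and (for $n\ge1$) $L_n^{(1)}=\mathrm{span}\{v_i: i\text{ odd}\}$. $\Re$ is generated by $A,B,C,\Delta$ with $[A,B]=[B,C]=[C,A]=2\Delta$ and $\alpha=[A,\Delta]+AC-BA$, $\beta=[B,\Delta]+BA-CB$, $\gamma=[C,\Delta]+CB-AC$ central; $\delta=A+B+C$. $\sharp:\Re\to U(\mathfrak{sl}_2)$ is the algebra homomorphism with $A\mapsto \frac{(E+F-2)(E+F+2)}{16}$, $B\mapsto\frac{(H-2)(H+2)}{16}$, $C\mapsto\frac{(\mathbf iE-\mathbf iF-2)(\mathbf iE-\mathbf iF+2)}{16}$, $\Delta\mapsto\frac{(H+2)F^2-(H-2)E^2}{64}$ ($\mathbf i=\sqrt{-1}$); its image preserves $L_n^{(0)}$ and $L_n^{(1)}$, making them $\Re$-modules. For $a,b,c\in\mathbb C$, $d\in\mathbb N$, $R_d(a,b,c)$ is the $(d+1)$-dimensional $\Re$-module (determined up to isomorphism) with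 a basis in which $A$ is lower bidiagonal with diagonal $\theta_i=(a+\frac d2-i)(a+\frac d2-i+1)$ and subdiagonal entries $1$, $B$ is upper bidiagonal with diagonal $\theta^*_i=(b+\frac d2-i)(b+\frac d2-i+1)$ and superdiagonal $\varphi_i=i(i-d-1)(a+b+c+\frac d2-i+2)(a+b-c+\frac d2-i+1)$, and $\alpha,\beta,\gamma,\delta$ act as the scalars $(c-b)(c+b+1)(a-\frac d2)(a+\frac d2+1)$, $(a-c)(a+c+1)(b-\frac d2)(b+\frac d2+1)$, $(b-a)(b+a+1)(c-\frac d2)(c+\frac d2+1)$, $\frac d2(\frac d2+1)+a(a+1)+b(b+1)+c(c+1)$. *)

theory Defs
  imports Complex_Main "Jordan_Normal_Form.Matrix"
begin

text \<open>A finite-dimensional module of the algebra generated by A, B, C, Delta is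
  recorded by the four matrices through which A, B, C, Delta act (w.r.t. a basis).\<close>
type_synonym rep = "complex mat \<times> complex mat \<times> complex mat \<times> complex mat"

definition rep_mats :: "rep \<Rightarrow> complex mat list" where
  "rep_mats r = (case r of (a, b, c, d) \<Rightarrow> [a, b, c, d])"

definition rep_iso :: "nat \<Rightarrow> rep \<Rightarrow> rep \<Rightarrow> bool" where
  "rep_iso m r s \<longleftrightarrow>
     (\<forall>X\<in>set (rep_mats r). X \<in> carrier_mat m m) \<and>
     (\<forall>X\<in>set (rep_mats s). X \<in> carrier_mat m m) \<and>
     (\<exists>P\<in>carrier_mat m m. invertible_mat P \<and>
        (\<forall>k<4. P * (rep_mats r ! k) = (rep_mats s ! k) * P))"

definition rep_irreducible :: "nat \<Rightarrow> rep \<Rightarrow> bool" where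
  "rep_irreducible m r \<longleftrightarrow> 0 < m \<and>
     (\<forall>X\<in>set (rep_mats r). X \<in> carrier_mat m m) \<and>
     (\<forall>W. W \<subseteq> carrier_vec m \<and> 0\<^sub>v m \<in> W \<and>
          (\<forall>u\<in>W. \<forall>v\<in>W. u + v \<in> W) \<and> (\<forall>c::complex. \<forall>u\<in>W. c \<cdot>\<^sub>v u \<in> W) \<and>
          (\<forall>X\<in>set (rep_mats r). \<forall>u\<in>W. X *\<^sub>v u \<in> W)
        \<longrightarrow> W = {0\<^sub>v m} \<or> W = carrier_vec m)"

definition blockdiag :: "nat \<Rightarrow> nat \<Rightarrow> complex mat \<Rightarrow> complex mat \<Rightarrow> complex mat" where
  "blockdiag k l X Y = four_block_mat X (0\<^sub>m k l) (0\<^sub>m l k) Y"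

definition rep_sum :: "nat \<Rightarrow> nat \<Rightarrow> rep \<Rightarrow> rep \<Rightarrow> rep" where
  "rep_sum k l r s = (case r of (a1, b1, c1, d1) \<Rightarrow> case s of (a2, b2, c2, d2) \<Rightarrow>
     (blockdiag k l a1 a2, blockdiag k l b1 b2, blockdiag k l c1 c2, blockdiag k l d1 d2))"

section \<open>The sl2-module L_n (basis v_0..v_n, index i = v_i)\<close>

definition E_mat :: "nat \<Rightarrow> complex mat" where
  "E_mat n = mat (n+1) (n+1) (\<lambda>(i,j). if j = i + 1 then of_nat (n - j + 1) else 0)"

definition F_mat :: "nat \<Rightarrow> complex mat" where
  "F_mat n = mat (n+1) (n+1) (\<lambda>(i,j). if i = j + 1 then of_nat (j + 1) else 0)"

definition H_mat :: "nat \<Rightarrow> complex mat" where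
  "H_mat n = mat (n+1) (n+1) (\<lambda>(i,j). if i = j then of_int (int n - 2 * int i) else 0)"

definition sharpA :: "nat \<Rightarrow> complex mat" where
  "sharpA n = (let I = 1\<^sub>m (n+1); S = E_mat n + F_mat n in
     (1/16) \<cdot>\<^sub>m ((S - 2 \<cdot>\<^sub>m I) * (S + 2 \<cdot>\<^sub>m I)))"

definition sharpB :: "nat \<Rightarrow> complex mat" where
  "sharpB n = (let I = 1\<^sub>m (n+1); H = H_mat n in
     (1/16) \<cdot>\<^sub>m ((H - 2 \<cdot>\<^sub>m I) * (H + 2 \<cdot>\<^sub>m I)))"

definition sharpC :: "nat \<Rightarrow> complex mat" where
  "sharpC n = (let I = 1\<^sub>m (n+1); S = \<i> \<cdot>\<^sub>m E_mat n - \<i> \<cdot>\<^sub>m F_mat n in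
     (1/16) \<cdot>\<^sub>m ((S - 2 \<cdot>\<^sub>m I) * (S + 2 \<cdot>\<^sub>m I)))"

definition sharpDelta :: "nat \<Rightarrow> complex mat" where
  "sharpDelta n = (let I = 1\<^sub>m (n+1); H = H_mat n; E = E_mat n; F = F_mat n in
     (1/64) \<cdot>\<^sub>m ((H + 2 \<cdot>\<^sub>m I) * (F * F) - (H - 2 \<cdot>\<^sub>m I) * (E * E)))"

text \<open>L_n^(0): span of v_i with i even, basis v_0, v_2, ..., of dimension n div 2 + 1.
  Since the sharp-images preserve it, the restricted action is the submatrix
  on even indices.\<close>
definition even_dim :: "nat \<Rightarrow> nat" where
  "even_dim n = n div 2 + 1"

definition even_part :: "nat \<Rightarrow> complex mat \<Rightarrow> complex mat" where
  "even_part n M = mat (even_dim n) (even_dim n) (\<lambda>(i,j). M $$ (2*i, 2*j))"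

definition L0_rep :: "nat \<Rightarrow> rep" where
  "L0_rep n = (even_part n (sharpA n), even_part n (sharpB n),
               even_part n (sharpC n), even_part n (sharpDelta n))"

definition Rdelta :: "nat \<Rightarrow> complex \<Rightarrow> complex \<Rightarrow> complex \<Rightarrow> complex" where
  "Rdelta d a b c = (let h = of_nat d / 2 in h * (h + 1) + a*(a+1) + b*(b+1) + c*(c+1))"

definition R_A :: "nat \<Rightarrow> complex \<Rightarrow> complex mat" where
  "R_A d a = mat (d+1) (d+1) (\<lambda>(i,j).
     if i = j then (a + of_nat d / 2 - of_nat i) * (a + of_nat d / 2 - of_nat i + 1)
     else if i = j + 1 then 1 else 0)"

definition R_phi :: "nat \<Rightarrow> complex \<Rightarrow> complex \<Rightarrow> complex \<Rightarrow> nat \<Rightarrow> complex" where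
  "R_phi d a b c i = of_nat i * (of_nat i - of_nat d - 1)
      * (a + b + c + of_nat d / 2 - of_nat i + 2) * (a + b - c + of_nat d / 2 - of_nat i + 1)"

definition R_B :: "nat \<Rightarrow> complex \<Rightarrow> complex \<Rightarrow> complex \<Rightarrow> complex mat" where
  "R_B d a b c = mat (d+1) (d+1) (\<lambda>(i,j).
     if i = j then (b + of_nat d / 2 - of_nat i) * (b + of_nat d / 2 - of_nat i + 1)
     else if j = i + 1 then R_phi d a b c j else 0)"

text \<open>C is determined by delta = A + B + C acting as a scalar, Delta by [A,B] = 2 Delta.\<close>
definition R_rep :: "nat \<Rightarrow> complex \<Rightarrow> complex \<Rightarrow> complex \<Rightarrow> rep" where
  "R_rep d a b c = (let A = R_A d a; B = R_B d a b c in
     (A, B, Rdelta d a b c \<cdot>\<^sub>m 1\<^sub>m (d+1) - A - B, (1/2) \<cdot>\<^sub>m (A * B - B * A)))"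

end

theory Submission
  imports Defs "Jordan_Normal_Form.Determinant"
begin

text \<open>
  On both sides C and Delta are determined by A and B, because A + B + C acts as a scalar and
  [A, B] = 2 Delta; so it suffices to intertwine A and B. Put x = n/2. In the basis v_0, v_2, ...
  of L_n^(0) the operator B is diagonal and A is tridiagonal.

  For odd n an upper triangular matrix with explicit entries (products of Pochhammer symbols)
  carries the pair into the bidiagonal form defining R_d(a,b,c). For even n the involution
  v_i \<mapsto> v_{n-i} commutes with A and B. Its (-1)- and (+1)-eigenspaces have bases
  v_{2i} - v_{n-2i} and v_{2i} + v_{n-2i}, in which A is the same tridiagonal matrix as
  before except for a correction in the last column. The same kind of triangular matrix handles them:
  as functions of x the parameters of all target modules fall into only two families, and
  the correction is exactly the defect by which the triangular matrix fails to close up.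

  Irreducibility is read off the tridiagonal form: B has distinct eigenvalues and the
  off-diagonal entries of A do not vanish.
\<close>

section \<open>Hypergeometric entries of the triangular matrix\<close>

text \<open>Why the correction fits: each family is an infinite triangular array that satisfies the
  relations with A and B for every x. Cutting it after column d leaves the relation with B intact
  and damages the relation with A only through column d + 1. For every target module
  \<open>phi\<close> vanishes at d + 1, so \<open>coef_B\<close> says that the entry in row i of
  column d + 1 times \<open>bdiag x i - bdiag x (d + 1)\<close> is zero. The entry can survive only
  at a coincidence of eigenvalues, i + d + 1 = x. For odd n there is none, x not being an integer.
  For even n this i is the mirror image of d + 1 under the involution, hence the row into which
  folding returns the coefficient of A that leaves the range 0..d.

  Why there are two families: on L_n, E + F has the eigenvalues n - 2k, and for even n the
  involution acts on the corresponding eigenvector by the sign of parity k. The values of (E + F -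
  2)(E + F + 2)/16 for even k and for odd k are the two forms of \<open>adiag\<close>.\<close>

text \<open>
  The matrix entries of A and the eigenvalues of B in the basis v_0, v_2, ... of L_n^(0), for
  x = n/2. The flag in the definitions below selects the family: True for the modules with
  a + d/2 = x/2 - 1/2 (fixed by the involution if n is even), False for those with
  a + d/2 = x/2 - 1.
\<close>

definition tri :: "complex \<Rightarrow> nat \<Rightarrow> nat \<Rightarrow> complex" where
  "tri x i j = (if i = j then (x + 4 * x * of_nat i - 4 * (of_nat i)\<^sup>2 - 2) / 8
     else if i = j + 1 then (of_nat j + 1/2) * (of_nat j + 1) / 4
     else if j = i + 1 then (x - of_nat i - 1/2) * (x - of_nat i) / 4 else 0)"

definition bdiag :: "complex \<Rightarrow> nat \<Rightarrow> complex" where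
  "bdiag x i = (x / 2 - of_nat i)\<^sup>2 - 1/4"

definition adiag :: "bool \<Rightarrow> complex \<Rightarrow> nat \<Rightarrow> complex" where
  "adiag s x j = (if s then (x / 2 - of_nat j)\<^sup>2 - 1/4
     else (x / 2 - of_nat j) * (x / 2 - of_nat j - 1))"

text \<open>The factor j - d - 1 of \<open>R_phi\<close> hides in a different place for each target:
  it is, up to sign and a factor 2, x + 1/2 - j for odd n, x + 2 - 2j for R_{n/4} and for n = 0, x -
  2j for R_{n/4-1}, and x + 1 - 2j for both modules when n is 2 modulo 4.\<close>

definition phi :: "bool \<Rightarrow> complex \<Rightarrow> nat \<Rightarrow> complex" where
  "phi s x j = - of_nat j * (x + 1 - 2 * of_nat j) * (x + 1/2 - of_nat j)
      * (if s then x + 2 - 2 * of_nat j else x - 2 * of_nat j) / 4"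

text \<open>The polynomial form of (y)_{2p} / (y+1)_p in the family True and of (y+1)_{2p} / (y+1)_p
  in the family False. The numerator comes from \<open>phi\<close>, the denominator from the
  eigenvalue differences of B. The value at p = 0 is separate because the truncated p - 1 would
  leave the factor y.\<close>

definition poch_tail :: "bool \<Rightarrow> complex \<Rightarrow> nat \<Rightarrow> complex" where
  "poch_tail s y p = (if s then if p = 0 then 1 else y * pochhammer (y + of_nat p + 1) (p - 1)
     else pochhammer (y + of_nat p + 1) p)"

text \<open>
  The entry in row i and column i + p. It is forced up to normalisation by coef_B; cancelling the
  eigenvalue differences of B against phi leaves a polynomial in x, so that
  the identities below hold for all x.
\<close>

definition coef :: "bool \<Rightarrow> complex \<Rightarrow> nat \<Rightarrow> nat \<Rightarrow> complex" where
  "coef s x i p = (-1) ^ i * pochhammer (1/2) i * (fact (i + p) * (-1/4) ^ (i + p))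
     * inverse (fact p) * pochhammer (of_nat i + 1/2 - x) p * poch_tail s (2 * of_nat i - x) p"

lemma inverse_fact_rec:
  "inverse (fact p) = of_nat (Suc p) * (inverse (fact (Suc p)) :: complex)"
  by (simp add: field_simps del: of_nat_Suc)

text \<open>This is \<open>coef_B\<close> without the common factors: y + p + 1 stems from the
  eigenvalue difference of B, the two factors on the right from \<open>phi\<close>.\<close>

lemma poch_tail_Suc:
  "(y + of_nat p + 1) * poch_tail s y (Suc p)
     = (y + 2 * of_nat p + 1) * (if s then y + 2 * of_nat p else y + 2 * of_nat p + 2) * poch_tail s y p"
proof (cases s)
  case True
  show ?thesis
  proof (cases p)
    case (Suc b)
    have "(y + of_nat p + 1) * pochhammer (y + of_nat p + 1 + 1) p
        = pochhammer (y + of_nat p + 1) (Suc (Suc b))"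
      by (simp add: Suc pochhammer_rec)
    also have "\<dots> = pochhammer (y + of_nat p + 1) b * (y + 2 * of_nat p) * (y + 2 * of_nat p + 1)"
      by (simp add: Suc pochhammer_Suc algebra_simps)
    finally show ?thesis using True Suc by (simp add: poch_tail_def algebra_simps)
  qed (use True in \<open>simp add: poch_tail_def\<close>)
next
  case False
  have "(y + of_nat p + 1) * pochhammer (y + of_nat p + 1 + 1) (Suc p)
      = pochhammer (y + of_nat p + 1) (Suc (Suc p))"
    by (simp add: pochhammer_rec)
  also have "\<dots> = pochhammer (y + of_nat p + 1) p * (y + 2 * of_nat p + 1) * (y + 2 * of_nat p + 2)"
    by (simp add: pochhammer_Suc algebra_simps)
  finally show ?thesis using False by (simp add: poch_tail_def algebra_simps)
qed

text \<open>This is \<open>coef_A\<close> without the common factors, a contiguity relation between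
  Pochhammer products. At p = 0 the truncated \<open>p - 1\<close> is harmless, since its
  coefficient contains q.\<close>

lemma poch_tail_identity:
  assumes y: "y = 2 * i - x" and q: "q = of_nat p"
  shows "- i / 4 * (i - 1/2 - x) * poch_tail s (y - 2) (Suc p)
       + (x + 4 * x * i - 4 * i\<^sup>2 - 2) / 8 * (q + 1) * poch_tail s y p
       + (i + 1/2) * (x - i) / 4 * q * (q + 1) * poch_tail s (y + 2) (p - 1)
     = (if s then (x / 2 - (i + q))\<^sup>2 - 1/4 else (x / 2 - (i + q)) * (x / 2 - (i + q) - 1))
         * (q + 1) * poch_tail s y p
       - (i + q + 1) / 4 * (i + 1/2 - x + q) * poch_tail s y (Suc p)"
proof (cases s)
  case True
  \<comment> \<open>In this family \<open>poch_tail\<close> itself involves p - 1 and is also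
    evaluated at p - 1, so the common Pochhammer factor has length p - 2.\<close>
  consider "p = 0" | "p = 1" | c where "p = Suc (Suc c)" by (metis One_nat_def not0_implies_Suc)
  then show ?thesis
  proof cases
    case 1
    then show ?thesis using True unfolding y q by (simp add: poch_tail_def power2_eq_square field_simps)
  next
    case 2
    then show ?thesis using True unfolding y q by (simp add: poch_tail_def power2_eq_square field_simps)
  next
    case 3
    define z where "z = pochhammer (y + q + 2) c"
    have q': "q = of_nat c + 2" using q 3 by simp
    have t0: "poch_tail s y p = y * (y + q + 1) * z"
      using True 3 by (simp add: poch_tail_def z_def q' pochhammer_rec algebra_simps)
    have t1: "poch_tail s (y - 2) (Suc p) = (y - 2) * (y + q) * (y + q + 1) * z"
      using True 3 by (simp add: poch_tail_def z_def q' pochhammer_rec algebra_simps)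
    have t2: "poch_tail s (y + 2) (p - 1) = (y + 2) * z"
      using True 3 by (simp add: poch_tail_def z_def q' algebra_simps)
    have t3: "poch_tail s y (Suc p) = y * z * (y + 2 * q) * (y + 2 * q + 1)"
      using True 3 by (simp add: poch_tail_def z_def q' pochhammer_Suc algebra_simps)
    show ?thesis unfolding t0 t1 t2 t3 using True
      by (simp add: y power2_eq_square field_simps)
  qed
next
  case False
  show ?thesis
  proof (cases p)
    case 0
    then show ?thesis using False unfolding y q by (simp add: poch_tail_def power2_eq_square field_simps)
  next
    case (Suc b)
    define z where "z = pochhammer (y + q + 2) b"
    have q': "q = of_nat b + 1" using q Suc by simp
    have t0: "poch_tail s y p = (y + q + 1) * z"
      using False Suc by (simp add: poch_tail_def z_def q' pochhammer_rec algebra_simps)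
    have t1: "poch_tail s (y - 2) (Suc p) = (y + q) * (y + q + 1) * z"
      using False Suc by (simp add: poch_tail_def z_def q' pochhammer_rec algebra_simps)
    have t2: "poch_tail s (y + 2) (p - 1) = z"
      using False Suc by (simp add: poch_tail_def z_def q' algebra_simps)
    have t3: "poch_tail s y (Suc p) = z * (y + 2 * q + 1) * (y + 2 * q + 2)"
      using False Suc by (simp add: poch_tail_def z_def q' pochhammer_Suc algebra_simps)
    show ?thesis unfolding t0 t1 t2 t3 using False
      by (simp add: y power2_eq_square field_simps)
  qed
qed

text \<open>The relation with A just below the diagonal. It makes the diagonal entries the products
  of the subdiagonal entries of A, which fixes the normalisation.\<close>

lemma coef_diag_Suc: "tri x (Suc i) i * coef s x i 0 = coef s x (Suc i) 0"
  by (simp add: coef_def poch_tail_def tri_def pochhammer_Suc field_simps)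

lemma coef_diag_nonzero: "coef s x i 0 \<noteq> 0"
proof -
  have "pochhammer (1/2 :: complex) i \<noteq> 0"
  proof
    assume "pochhammer (1/2 :: complex) i = 0"
    then obtain k where "(1/2 :: complex) = - of_nat k"
      by (auto simp: pochhammer_eq_0_iff)
    then have "Re (1/2) = Re (- of_nat k)" by (rule arg_cong)
    then show False by simp
  qed
  then show ?thesis by (simp add: coef_def poch_tail_def)
qed

lemma coef_B:
  "(bdiag x i - bdiag x (i + Suc p)) * coef s x i (Suc p) = phi s x (i + Suc p) * coef s x i p"
proof -
  \<comment> \<open>Factoring out 1/(p+1)! instead of 1/p! lets neighbouring entries share a factor
    without division by p + 1.\<close>
  define w where "w = (inverse (fact (Suc p)) :: complex)"
  have w: "inverse (fact p) = of_nat (Suc p) * w" using inverse_fact_rec w_def by blast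
  define y where "y = 2 * of_nat i - x"
  define c where "c = (-1) ^ i * pochhammer (1/2::complex) i * (fact (i + p) * (-1/4) ^ (i + p))
    * pochhammer (of_nat i + 1/2 - x) p * w"
  define t t' where "t = poch_tail s y (Suc p)" and "t' = poch_tail s y p"
  have 1: "coef s x i (Suc p)
      = c * (of_nat (Suc (i + p)) * (-1/4)) * (of_nat i + 1/2 - x + of_nat p) * t"
    unfolding coef_def c_def w_def[symmetric] t_def y_def by (simp add: pochhammer_Suc)
  have 2: "coef s x i p = c * of_nat (Suc p) * t'"
    unfolding coef_def c_def w t'_def y_def by simp
  have 3: "bdiag x i - bdiag x (i + Suc p) = - of_nat (Suc p) * (y + of_nat p + 1)"
    unfolding bdiag_def y_def by (simp add: power2_eq_square field_simps)
  have arrange: "(- P * Y) * (c * (K * (-1/4)) * Z * t) = c * (K/4) * Z * P * (Y * t)"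
    for P Y K Z :: complex by simp
  have "(bdiag x i - bdiag x (i + Suc p)) * coef s x i (Suc p)
     = c * (of_nat (Suc (i + p)) / 4) * (of_nat i + 1/2 - x + of_nat p) * of_nat (Suc p)
        * ((y + of_nat p + 1) * t)"
    unfolding 1 3 by (rule arrange)
  also have "\<dots> = phi s x (i + Suc p) * coef s x i p"
    unfolding t_def poch_tail_Suc 2 phi_def t'_def[symmetric] unfolding y_def
    by (cases s) (simp_all add: field_simps)
  finally show ?thesis .
qed

text \<open>With u_j the j-th column, this is A u_j = \<open>adiag\<close> u_j + u_{j+1} in row i,
  for j = i + p. The guards stand for the missing row above the first and, at p = 0, for the zero
  entry below the diagonal.\<close>

lemma coef_A:
  "(if i = 0 then 0 else tri x i (i - 1) * coef s x (i - 1) (Suc p)) + tri x i i * coef s x i p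
     + (if p = 0 then 0 else tri x i (Suc i) * coef s x (Suc i) (p - 1))
   = adiag s x (i + p) * coef s x i p + coef s x i (Suc p)"
proof -
  define w where "w = (inverse (fact (Suc p)) :: complex)"
  have w: "inverse (fact p) = of_nat (Suc p) * w" using inverse_fact_rec w_def by blast
  define y where "y = 2 * of_nat i - x"
  define r where "r = pochhammer (of_nat i + 1/2 - x) p"
  define c where "c = (-1) ^ i * pochhammer (1/2::complex) i * (fact (i + p) * (-1/4) ^ (i + p)) * r * w"
  have 0: "coef s x i p = c * ((of_nat p + 1) * poch_tail s y p)"
    unfolding coef_def c_def w y_def r_def by (simp add: algebra_simps)
  have 1: "(if i = 0 then 0 else tri x i (i - 1) * coef s x (i - 1) (Suc p))
      = c * (- of_nat i / 4 * (of_nat i - 1/2 - x) * poch_tail s (y - 2) (Suc p))"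
  proof (cases i)
    case (Suc a)
    have r1: "pochhammer (of_nat a + 1/2 - x) (Suc p) = (of_nat i - 1/2 - x) * r"
      unfolding r_def Suc pochhammer_rec by (simp add: algebra_simps)
    have y1: "2 * of_nat a - x = y - 2" by (simp add: y_def Suc)
    have "tri x i (i - 1) * coef s x (i - 1) (Suc p) = tri x (Suc a) a *
       ((-1) ^ a * pochhammer (1/2) a * (fact (i + p) * (-1/4) ^ (i + p))
     * w * ((of_nat i - 1/2 - x) * r) * poch_tail s (y - 2) (Suc p))"
      unfolding Suc diff_Suc_1 coef_def y1 r1[unfolded Suc] w_def by simp
    then show ?thesis unfolding c_def tri_def by (simp add: Suc pochhammer_Suc field_simps)
  qed simp
  have 2: "(if p = 0 then 0 else tri x i (Suc i) * coef s x (Suc i) (p - 1))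
      = c * ((of_nat i + 1/2) * (x - of_nat i) / 4 * of_nat p * (of_nat p + 1) * poch_tail s (y + 2) (p - 1))"
  proof (cases p)
    case (Suc b)
    have w2: "inverse (fact b) = of_nat p * ((of_nat p + 1) * w)"
      using inverse_fact_rec[of b, unfolded inverse_fact_rec[of "Suc b"]]
      unfolding w_def Suc by (simp only: of_nat_Suc[of "Suc b"] add.commute)
    define r' where "r' = pochhammer (of_nat (Suc i) + 1/2 - x) b"
    have r2: "r = (of_nat i + 1/2 - x) * r'"
      unfolding r_def r'_def Suc pochhammer_rec by (simp add: algebra_simps)
    have y1: "2 * of_nat (Suc i) - x = y + 2" by (simp add: y_def)
    have "tri x i (Suc i) * coef s x (Suc i) (p - 1) = tri x i (Suc i) *
       ((-1) ^ Suc i * pochhammer (1/2) (Suc i) * (fact (i + p) * (-1/4) ^ (i + p))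
     * (of_nat p * ((of_nat p + 1) * w)) * r' * poch_tail s (y + 2) b)"
      unfolding w2[symmetric] unfolding Suc diff_Suc_1 coef_def y1 r'_def by simp
    then show ?thesis unfolding c_def tri_def r2
      by (simp add: Suc pochhammer_Suc field_simps)
  qed simp
  have 3: "coef s x i (Suc p)
      = - c * ((of_nat i + of_nat p + 1) / 4 * (of_nat i + 1/2 - x + of_nat p) * poch_tail s y (Suc p))"
    unfolding coef_def c_def w_def[symmetric] y_def r_def by (simp add: pochhammer_Suc field_simps)
  have 4: "tri x i i = (x + 4 * x * of_nat i - 4 * (of_nat i)\<^sup>2 - 2) / 8" by (simp add: tri_def)
  have 5: "adiag s x (i + p) = (if s then (x / 2 - (of_nat i + of_nat p))\<^sup>2 - 1/4
     else (x / 2 - (of_nat i + of_nat p)) * (x / 2 - (of_nat i + of_nat p) - 1))"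
    by (simp add: adiag_def)
  \<comment> \<open>The common factor c may vanish for special x, so the reduced identity is
    multiplied by c and nothing is cancelled.\<close>
  have lin: "c * u + a * (c * (k * t)) + c * v = b * (c * (k * t)) + - c * z"
    if "u + a * k * t + v = b * k * t - z" for u v z a b k t
    using arg_cong[OF that, of "(*) c"] by (simp add: algebra_simps)
  show ?thesis
    unfolding 0 1 2 3 4 5 by (rule lin[OF poch_tail_identity[OF y_def refl]])
qed

section \<open>Modules determined by the action of A and B\<close>

definition rep_of :: "nat \<Rightarrow> complex \<Rightarrow> complex mat \<Rightarrow> complex mat \<Rightarrow> rep" where
  "rep_of m \<delta> A B = (A, B, \<delta> \<cdot>\<^sub>m 1\<^sub>m m - A - B, (1/2) \<cdot>\<^sub>m (A * B - B * A))"

definition pair_similar ::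
    "complex mat \<Rightarrow> complex mat \<Rightarrow> complex mat \<Rightarrow> complex mat \<Rightarrow> bool" where
  "pair_similar A B A' B' \<longleftrightarrow> (\<exists>P Q. similar_mat_wit A A' P Q \<and> similar_mat_wit B B' P Q)"

lemma pair_similar_trans:
  "pair_similar A B A' B' \<Longrightarrow> pair_similar A' B' A'' B'' \<Longrightarrow> pair_similar A B A'' B''"
  unfolding pair_similar_def by (meson similar_mat_wit_trans)

lemma pair_similarI:
  assumes "A \<in> carrier_mat m m" "B \<in> carrier_mat m m" "A' \<in> carrier_mat m m" "B' \<in> carrier_mat m m"
    and Q: "Q \<in> carrier_mat m m" and P: "P \<in> carrier_mat m m" and PQ: "P * Q = 1\<^sub>m m"
    and AQ: "A * Q = Q * A'" and BQ: "B * Q = Q * B'"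
  shows "pair_similar A B A' B'"
proof -
  have QP: "Q * P = 1\<^sub>m m" using mat_mult_left_right_inverse[OF P Q PQ] .
  have "similar_mat_wit X X' Q P"
    if X: "X \<in> carrier_mat m m" "X' \<in> carrier_mat m m" and XQ: "X * Q = Q * X'" for X X'
  proof (rule similar_mat_witI[OF QP PQ _ X Q P])
    have "X = X * (Q * P)" using X QP by simp
    also have "\<dots> = Q * X' * P" using assoc_mult_mat[OF X(1) Q P] XQ by simp
    finally show "X = Q * X' * P" .
  qed
  then show ?thesis using assms unfolding pair_similar_def by blast
qed

lemma pair_similar_blockdiag:
  assumes 1: "pair_similar A1 B1 A1' B1'" and 2: "pair_similar A2 B2 A2' B2'"
    and c: "A1 \<in> carrier_mat k k" "B1 \<in> carrier_mat k k" "A2 \<in> carrier_mat l l" "B2 \<in> carrier_mat l l"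
  shows "pair_similar (blockdiag k l A1 A2) (blockdiag k l B1 B2)
           (blockdiag k l A1' A2') (blockdiag k l B1' B2')"
proof -
  obtain P1 Q1 where 1: "similar_mat_wit A1 A1' P1 Q1" "similar_mat_wit B1 B1' P1 Q1"
    using 1 pair_similar_def by blast
  obtain P2 Q2 where 2: "similar_mat_wit A2 A2' P2 Q2" "similar_mat_wit B2 B2' P2 Q2"
    using 2 pair_similar_def by blast
  note d1 = similar_mat_witD2[OF c(1) 1(1)]
  note d2 = similar_mat_witD2[OF c(3) 2(1)]
  \<comment> \<open>The block conjugation rule asks for the off-diagonal blocks as conjugates too;
    zero blocks qualify.\<close>
  have z: "0\<^sub>m k l = P1 * 0\<^sub>m k l * Q2" "0\<^sub>m l k = P2 * 0\<^sub>m l k * Q1"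
    using d1(6,7) d2(6,7) by auto
  show ?thesis unfolding pair_similar_def blockdiag_def
    using similar_mat_wit_four_block[OF 1(1) 2(1) z c(1) c(3)]
      similar_mat_wit_four_block[OF 1(2) 2(2) z c(2) c(4)] by auto
qed

lemma rep_iso_rep_of:
  assumes sim: "pair_similar A B A' B'" and A: "A \<in> carrier_mat m m" and B: "B \<in> carrier_mat m m"
  shows "rep_iso m (rep_of m \<delta> A B) (rep_of m \<delta> A' B')"
proof -
  obtain Q P where 1: "similar_mat_wit A A' Q P" "similar_mat_wit B B' Q P"
    using sim pair_similar_def by blast
  note a = similar_mat_witD2[OF A 1(1)] and b = similar_mat_witD2[OF B 1(2)]
  have comm: "P * X = X' * P" if "X = Q * X' * P" "X' \<in> carrier_mat m m" for X X'
  proof -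
    have "P * X = P * (Q * (X' * P))" using that a(6,7) by simp
    also have "\<dots> = (P * Q) * (X' * P)"
      using assoc_mult_mat[OF a(7) a(6), of "X' * P" m] that a(7) by simp
    also have "\<dots> = X' * P" using a(2) that a(7) by simp
    finally show ?thesis .
  qed
  have PA: "P * A = A' * P" and PB: "P * B = B' * P" using comm a b by blast+
  have P: "P \<in> carrier_mat m m" and A': "A' \<in> carrier_mat m m" and B': "B' \<in> carrier_mat m m"
    using a b by auto
  have PAB: "P * (X * Y) = (X' * Y') * P"
    if "X \<in> carrier_mat m m" "X' \<in> carrier_mat m m" "Y \<in> carrier_mat m m" "Y' \<in> carrier_mat m m"
      "P * X = X' * P" "P * Y = Y' * P" for X Y X' Y'
  proof -
    have "P * (X * Y) = P * X * Y" by (rule assoc_mult_mat[OF P that(1) that(3), symmetric])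
    also have "\<dots> = X' * (P * Y)" unfolding that(5) by (rule assoc_mult_mat[OF that(2) P that(3)])
    also have "\<dots> = X' * Y' * P"
      unfolding that(6) by (rule assoc_mult_mat[OF that(2) that(4) P, symmetric])
    finally show ?thesis .
  qed
  have right: "P * (X - Y) = P * X - P * Y" if "X \<in> carrier_mat m m" "Y \<in> carrier_mat m m" for X Y
    using mult_minus_distrib_mat[OF P that] .
  have left: "(X - Y) * P = X * P - Y * P" if "X \<in> carrier_mat m m" "Y \<in> carrier_mat m m" for X Y
    using minus_mult_distrib_mat[OF that P] .
  have PC: "P * (\<delta> \<cdot>\<^sub>m 1\<^sub>m m - A - B) = (\<delta> \<cdot>\<^sub>m 1\<^sub>m m - A' - B') * P"
  proof -
    have "P * (\<delta> \<cdot>\<^sub>m 1\<^sub>m m - A - B) = P * (\<delta> \<cdot>\<^sub>m 1\<^sub>m m) - P * A - P * B"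
      using A B by (simp add: right minus_carrier_mat)
    also have "\<dots> = (\<delta> \<cdot>\<^sub>m 1\<^sub>m m) * P - A' * P - B' * P"
      using P by (simp add: PA PB mult_smult_distrib[of _ m m _ m] mult_smult_assoc_mat[of _ m m _ m])
    also have "\<dots> = (\<delta> \<cdot>\<^sub>m 1\<^sub>m m - A' - B') * P"
      using A' B' by (simp add: left minus_carrier_mat)
    finally show ?thesis .
  qed
  have PD: "P * ((1/2) \<cdot>\<^sub>m (A * B - B * A)) = (1/2) \<cdot>\<^sub>m (A' * B' - B' * A') * P"
  proof -
    have c: "A * B \<in> carrier_mat m m" "B * A \<in> carrier_mat m m"
      "A' * B' \<in> carrier_mat m m" "B' * A' \<in> carrier_mat m m" using A B A' B' by auto
    have "P * ((1/2) \<cdot>\<^sub>m (A * B - B * A)) = (1/2) \<cdot>\<^sub>m (P * (A * B) - P * (B * A))"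
      using P c by (simp add: right mult_smult_distrib[of _ m m _ m] minus_carrier_mat)
    also have "\<dots> = (1/2) \<cdot>\<^sub>m (A' * B' * P - B' * A' * P)"
      using PAB[OF A A' B B' PA PB] PAB[OF B B' A A' PB PA] by simp
    also have "\<dots> = (1/2) \<cdot>\<^sub>m (A' * B' - B' * A') * P"
      using P c by (simp add: left mult_smult_assoc_mat[of _ m m _ m] minus_carrier_mat)
    finally show ?thesis .
  qed
  have "invertible_mat P" unfolding invertible_mat_def inverts_mat_def
    using a P by (intro conjI exI[of _ Q]) auto
  moreover have "\<forall>k<4. P * (rep_mats (rep_of m \<delta> A B) ! k) = (rep_mats (rep_of m \<delta> A' B') ! k) * P"
    using PA PB PC PD by (auto simp: rep_mats_def rep_of_def less_Suc_eq numeral_eq_Suc)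
  ultimately show ?thesis unfolding rep_iso_def using A B A' B' P
    by (auto simp: rep_mats_def rep_of_def)
qed

lemma rep_sum_rep_of:
  assumes "A1 \<in> carrier_mat k k" "B1 \<in> carrier_mat k k" "A2 \<in> carrier_mat l l" "B2 \<in> carrier_mat l l"
  shows "rep_sum k l (rep_of k \<delta> A1 B1) (rep_of l \<delta> A2 B2)
    = rep_of (k + l) \<delta> (blockdiag k l A1 A2) (blockdiag k l B1 B2)"
proof -
  have mult: "blockdiag k l X1 X2 * blockdiag k l Y1 Y2 = blockdiag k l (X1 * Y1) (X2 * Y2)"
    if "X1 \<in> carrier_mat k k" "Y1 \<in> carrier_mat k k" "X2 \<in> carrier_mat l l" "Y2 \<in> carrier_mat l l"
    for X1 X2 Y1 Y2
    unfolding blockdiag_def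
    using mult_four_block_mat[OF that(1) zero_carrier_mat zero_carrier_mat that(3)
        that(2) zero_carrier_mat zero_carrier_mat that(4)] that
    by simp
  show ?thesis unfolding rep_sum_def rep_of_def using assms
    by (auto simp: mult) (auto intro!: eq_matI simp: blockdiag_def)
qed

lemma smult_mat_mult_vec:
  assumes "A \<in> carrier_mat nr nc" "v \<in> carrier_vec nc"
  shows "(k \<cdot>\<^sub>m A) *\<^sub>v v = k \<cdot>\<^sub>v (A *\<^sub>v v :: 'a :: comm_semiring_1 vec)"
  using assms by (intro eq_vecI) (auto simp: scalar_prod_def sum_distrib_left mult.assoc)

lemma mult_mat_zero_vec:
  "A \<in> carrier_mat nr nc \<Longrightarrow> A *\<^sub>v 0\<^sub>v nc = (0\<^sub>v nr :: 'a :: comm_semiring_1 vec)"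
  by (intro eq_vecI) (auto simp: scalar_prod_def)

lemma rep_of_invariant:
  assumes A: "A \<in> carrier_mat m m" and B: "B \<in> carrier_mat m m" and V: "V \<subseteq> carrier_vec m"
    and add: "\<forall>u\<in>V. \<forall>v\<in>V. u + v \<in> V" and smult: "\<forall>c::complex. \<forall>u\<in>V. c \<cdot>\<^sub>v u \<in> V"
    and VA: "\<And>v. v \<in> V \<Longrightarrow> A *\<^sub>v v \<in> V" and VB: "\<And>v. v \<in> V \<Longrightarrow> B *\<^sub>v v \<in> V"
  shows "\<forall>X\<in>set (rep_mats (rep_of m \<delta> A B)). \<forall>u\<in>V. X *\<^sub>v u \<in> V"
proof -
  have minus: "u - v \<in> V" if "u \<in> V" "v \<in> V" for u v
  proof -
    have "u - v = u + (-1) \<cdot>\<^sub>v v" using that V by (intro eq_vecI) auto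
    then show ?thesis using that add smult by auto
  qed
  have "(\<delta> \<cdot>\<^sub>m 1\<^sub>m m - A - B) *\<^sub>v u \<in> V" if u: "u \<in> V" for u
  proof -
    have u': "u \<in> carrier_vec m" using u V by auto
    have "(\<delta> \<cdot>\<^sub>m 1\<^sub>m m - A - B) *\<^sub>v u = \<delta> \<cdot>\<^sub>v u - A *\<^sub>v u - B *\<^sub>v u"
      using u' A B by (simp add: minus_mult_distrib_mat_vec[of _ m m] smult_mat_mult_vec[of _ m m] minus_carrier_mat)
    then show ?thesis using u minus VA VB smult by auto
  qed
  moreover have "((1/2) \<cdot>\<^sub>m (A * B - B * A)) *\<^sub>v u \<in> V" if u: "u \<in> V" for u
  proof -
    have u': "u \<in> carrier_vec m" using u V by auto
    have c: "A * B \<in> carrier_mat m m" "B * A \<in> carrier_mat m m" using A B by auto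
    have "((1/2) \<cdot>\<^sub>m (A * B - B * A)) *\<^sub>v u = (1/2) \<cdot>\<^sub>v (A *\<^sub>v (B *\<^sub>v u) - B *\<^sub>v (A *\<^sub>v u))"
      using u' A B c by (simp add: minus_mult_distrib_mat_vec[of _ m m] smult_mat_mult_vec[of _ m m]
          minus_carrier_mat)
    then show ?thesis using u minus VA VB smult by auto
  qed
  ultimately show ?thesis using VA VB by (auto simp: rep_mats_def rep_of_def)
qed

text \<open>Needed because irreducibility is visible in the basis where B is diagonal, whereas the
  target modules are given in a bidiagonal basis.\<close>

lemma rep_irreducible_similar:
  assumes irr: "rep_irreducible m (rep_of m \<delta> A B)" and sim: "pair_similar A B A' B'"
  shows "rep_irreducible m (rep_of m \<delta> A' B')"
proof -
  have A: "A \<in> carrier_mat m m" and B: "B \<in> carrier_mat m m" and m: "0 < m"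
    using irr by (auto simp: rep_irreducible_def rep_mats_def rep_of_def)
  obtain Q P where 1: "similar_mat_wit A A' Q P" "similar_mat_wit B B' Q P"
    using sim pair_similar_def by blast
  note a = similar_mat_witD2[OF A 1(1)] and b = similar_mat_witD2[OF B 1(2)]
  have "W = {0\<^sub>v m} \<or> W = carrier_vec m"
    if W: "W \<subseteq> carrier_vec m" "0\<^sub>v m \<in> W" "\<forall>u\<in>W. \<forall>v\<in>W. u + v \<in> W"
      "\<forall>c::complex. \<forall>u\<in>W. c \<cdot>\<^sub>v u \<in> W"
      "\<forall>X\<in>set (rep_mats (rep_of m \<delta> A' B')). \<forall>u\<in>W. X *\<^sub>v u \<in> W" for W
  proof -
    \<comment> \<open>The preimage of W under the intertwiner is again invariant, and P is
      bijective.\<close>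
    define V where "V = {v \<in> carrier_vec m. P *\<^sub>v v \<in> W}"
    have P: "P \<in> carrier_mat m m" and Q: "Q \<in> carrier_mat m m" using a by auto
    have PQv: "P *\<^sub>v (Q *\<^sub>v v) = v" if "v \<in> carrier_vec m" for v
      using assoc_mult_mat_vec[OF P Q that] a(2) that by auto
    have W': "A' *\<^sub>v u \<in> W" "B' *\<^sub>v u \<in> W" if "u \<in> W" for u
      using W(5) that by (auto simp: rep_mats_def rep_of_def)
    have PX: "P *\<^sub>v (X *\<^sub>v v) = X' *\<^sub>v (P *\<^sub>v v)"
      if "X = Q * X' * P" "X' \<in> carrier_mat m m" "v \<in> carrier_vec m" for X X' v
    proof -
      have "X *\<^sub>v v = Q *\<^sub>v (X' *\<^sub>v (P *\<^sub>v v))"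
        unfolding that(1) using assoc_mult_mat_vec[of "Q * X'" m m P m v]
          assoc_mult_mat_vec[of Q m m X' m "P *\<^sub>v v"] P Q that by simp
      then show ?thesis using PQv[of "X' *\<^sub>v (P *\<^sub>v v)"] P that by simp
    qed
    have VA: "A *\<^sub>v v \<in> V" and VB: "B *\<^sub>v v \<in> V" if "v \<in> V" for v
      using that W' PX[OF a(3) a(5)] PX[OF b(3) b(5)] A B unfolding V_def by auto
    have V: "V \<subseteq> carrier_vec m" "0\<^sub>v m \<in> V" "\<forall>u\<in>V. \<forall>v\<in>V. u + v \<in> V"
      "\<forall>c::complex. \<forall>u\<in>V. c \<cdot>\<^sub>v u \<in> V"
      using W P unfolding V_def
      by (auto simp: mult_add_distrib_mat_vec[OF P] mult_mat_vec[OF P] mult_mat_zero_vec[OF P])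
    have "\<forall>X\<in>set (rep_mats (rep_of m \<delta> A B)). \<forall>u\<in>V. X *\<^sub>v u \<in> V"
      using rep_of_invariant[OF A B V(1,3,4)] VA VB by blast
    then consider "V = {0\<^sub>v m}" | "V = carrier_vec m"
      using irr V unfolding rep_irreducible_def by blast
    then show ?thesis
    proof cases
      case 1
      have "w = 0\<^sub>v m" if "w \<in> W" for w
      proof -
        have w: "w \<in> carrier_vec m" using W that by auto
        then have "Q *\<^sub>v w \<in> V" unfolding V_def using PQv that Q by auto
        then have "P *\<^sub>v (Q *\<^sub>v w) = P *\<^sub>v 0\<^sub>v m" using 1 by simp
        then show ?thesis using PQv[OF w] mult_mat_zero_vec[OF P] by simp
      qed
      then show ?thesis using W(2) by blast
    next
      case 2
      have "w \<in> W" if w: "w \<in> carrier_vec m" for w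
      proof -
        have "Q *\<^sub>v w \<in> V" using 2 Q w by auto
        then show ?thesis unfolding V_def using PQv[OF w] by simp
      qed
      then show ?thesis using W(1) by blast
    qed
  qed
  moreover have "\<forall>X\<in>set (rep_mats (rep_of m \<delta> A' B')). X \<in> carrier_mat m m"
    using a(5) b(5) by (auto simp: rep_mats_def rep_of_def)
  ultimately show ?thesis unfolding rep_irreducible_def using m by blast
qed

section \<open>Tridiagonal pairs\<close>

lemma sum_tridiagonal:
  fixes g :: "nat \<Rightarrow> 'a :: comm_monoid_add"
  assumes i: "i < m" and g: "\<And>r. r + 1 < i \<or> i + 1 < r \<Longrightarrow> g r = 0"
  shows "(\<Sum>r = 0..<m. g r)
    = (if i = 0 then 0 else g (i - 1)) + g i + (if i + 1 < m then g (i + 1) else 0)"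
proof -
  define S where "S = (if i = 0 then {} else {i - 1}) \<union> {i} \<union> (if i + 1 < m then {i + 1} else {})"
  have "(\<Sum>r = 0..<m. g r) = sum g S"
  proof (rule sum.mono_neutral_right)
    show "\<forall>r\<in>{0..<m} - S. g r = 0"
    proof
      fix r assume r: "r \<in> {0..<m} - S"
      have "r + 1 < i \<or> i + 1 < r"
      proof (rule ccontr)
        assume "\<not> ?thesis"
        then have "r = i \<or> (i \<noteq> 0 \<and> r = i - 1) \<or> r = i + 1" by linarith
        then show False using r by (auto simp: S_def split: if_splits)
      qed
      then show "g r = 0" by (rule g)
    qed
  qed (use i in \<open>auto simp: S_def split: if_splits\<close>)
  also have "\<dots> = (if i = 0 then 0 else g (i - 1)) + g i + (if i + 1 < m then g (i + 1) else 0)"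
    by (cases i) (auto simp: S_def ac_simps)
  finally show ?thesis .
qed

text \<open>Lagrange interpolation in B isolates every nonzero coordinate: if an element of W has a
  nonzero i-th coordinate, the i-th unit vector lies in W. Applying A to it gives nonzero
  coordinates at the neighbouring indices, so all unit vectors follow.\<close>

lemma rep_irreducible_tridiagonal:
  assumes A: "A \<in> carrier_mat m m" and B: "B \<in> carrier_mat m m" and m: "0 < m"
    and diag: "\<And>i j. i < m \<Longrightarrow> j < m \<Longrightarrow> B $$ (i, j) = (if i = j then t i else 0)"
    and dist: "\<And>i j. i < j \<Longrightarrow> j < m \<Longrightarrow> t i \<noteq> t j"
    and sub: "\<And>i. Suc i < m \<Longrightarrow> A $$ (Suc i, i) \<noteq> 0"
    and sup: "\<And>i. Suc i < m \<Longrightarrow> A $$ (i, Suc i) \<noteq> 0"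
  shows "rep_irreducible m (rep_of m \<delta> A B)"
proof -
  have "W = {0\<^sub>v m} \<or> W = carrier_vec m"
    if W: "W \<subseteq> carrier_vec m" "0\<^sub>v m \<in> W" and add: "\<And>u v. u \<in> W \<Longrightarrow> v \<in> W \<Longrightarrow> u + v \<in> W"
      and smult: "\<And>c u. u \<in> W \<Longrightarrow> c \<cdot>\<^sub>v u \<in> W"
      and WA: "\<And>u. u \<in> W \<Longrightarrow> A *\<^sub>v u \<in> W" and WB: "\<And>u. u \<in> W \<Longrightarrow> B *\<^sub>v u \<in> W" for W
  proof (cases "W = {0\<^sub>v m}")
    case False
    have unit: "unit_vec m i \<in> W" if v: "v \<in> W" and i: "i < m" and vi: "v $ i \<noteq> 0" for v i
    proof -
      \<comment> \<open>The vector is the product of the B - t k over K, applied to v. Taking for K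
        all indices except i leaves a multiple of the i-th unit vector.\<close>
      have filt: "vec m (\<lambda>r. v $ r * (\<Prod>k\<in>K. t r - t k)) \<in> W" if "finite K" for K
        using that
      proof induction
        case empty
        have "vec m (\<lambda>r. v $ r * (\<Prod>k\<in>{}. t r - t k)) = v" using v W by (intro eq_vecI) auto
        then show ?case using v by simp
      next
        case (insert k K)
        let ?w = "vec m (\<lambda>r. v $ r * (\<Prod>k\<in>K. t r - t k))"
        have "B *\<^sub>v ?w = vec m (\<lambda>r. t r * (v $ r * (\<Prod>k\<in>K. t r - t k)))"
        proof (rule eq_vecI)
          fix r assume "r < dim_vec (vec m (\<lambda>r. t r * (v $ r * (\<Prod>k\<in>K. t r - t k))))"
          then have r: "r < m" by simp
          have "(B *\<^sub>v ?w) $ r = (\<Sum>j = 0..<m. B $$ (r, j) * ?w $ j)"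
            using r B by (simp add: scalar_prod_def)
          also have "\<dots> = (\<Sum>j = 0..<m. if j = r then t r * ?w $ r else 0)"
            by (rule sum.cong) (use r diag in auto)
          finally show "(B *\<^sub>v ?w) $ r = vec m (\<lambda>r. t r * (v $ r * (\<Prod>k\<in>K. t r - t k))) $ r"
            using r by simp
        qed (use B in auto)
        then have "vec m (\<lambda>r. v $ r * (\<Prod>k\<in>insert k K. t r - t k)) = B *\<^sub>v ?w + (- t k) \<cdot>\<^sub>v ?w"
          using insert by (intro eq_vecI) (auto simp: algebra_simps)
        then show ?case using insert add smult WB by auto
      qed
      define c where "c = v $ i * (\<Prod>k\<in>{..<m} - {i}. t i - t k)"
      have c: "c \<noteq> 0" using vi dist i unfolding c_def
        by (auto simp: nat_neq_iff) metis
      have "unit_vec m i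
          = inverse c \<cdot>\<^sub>v vec m (\<lambda>r. v $ r * (\<Prod>k\<in>{..<m} - {i}. t r - t k))"
      proof (rule eq_vecI)
        fix r assume "r < dim_vec (inverse c \<cdot>\<^sub>v vec m (\<lambda>r. v $ r * (\<Prod>k\<in>{..<m} - {i}. t r - t k)))"
        then have r: "r < m" by simp
        have "(\<Prod>k\<in>{..<m} - {i}. t r - t k) = 0" if "r \<noteq> i"
          using r that by (intro prod_zero) auto
        then show "unit_vec m i $ r
            = (inverse c \<cdot>\<^sub>v vec m (\<lambda>r. v $ r * (\<Prod>k\<in>{..<m} - {i}. t r - t k))) $ r"
          using r i left_inverse[OF c] by (cases "r = i") (auto simp flip: c_def)
      qed auto
      then show ?thesis using smult filt[of "{..<m} - {i}"] by simp
    qed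
    have col: "A *\<^sub>v unit_vec m i = col A i" if "i < m" for i
      using A that by (intro eq_vecI) auto
    have up: "unit_vec m (Suc i) \<in> W" if "unit_vec m i \<in> W" "Suc i < m" for i
      using unit[OF WA[OF that(1)], of "Suc i"] that A sub col[of i] by auto
    have down: "unit_vec m i \<in> W" if "unit_vec m (Suc i) \<in> W" "Suc i < m" for i
      using unit[OF WA[OF that(1)], of i] that A sup col[of "Suc i"] by auto
    obtain v where v: "v \<in> W" "v \<noteq> 0\<^sub>v m" using False W by auto
    then obtain i where i: "i < m" "v $ i \<noteq> 0" using W by (metis carrier_vecD eq_vecI index_zero_vec subsetD)
    \<comment> \<open>Descent from i to 0; truncated subtraction makes all steps beyond j = i
      trivial.\<close>
    have "unit_vec m (i - j) \<in> W" for j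
    proof (induction j)
      case (Suc j)
      then show ?case using down[of "i - Suc j"] i
        by (cases "j < i") (auto simp: Suc_diff_Suc)
    qed (use unit v i in simp)
    from this[of i] have zero: "unit_vec m 0 \<in> W" by simp
    have all: "unit_vec m j \<in> W" if "j < m" for j
      using that by (induction j) (use zero up in auto)
    have "w \<in> W" if w: "w \<in> carrier_vec m" for w
    proof -
      have "k \<le> m \<Longrightarrow> vec m (\<lambda>r. if r < k then w $ r else 0) \<in> W" for k
      proof (induction k)
        case 0
        have "vec m (\<lambda>r. if r < 0 then w $ r else 0) = 0\<^sub>v m" by (intro eq_vecI) auto
        then show ?case using W by simp
      next
        case (Suc k)
        have "vec m (\<lambda>r. if r < Suc k then w $ r else 0)
            = vec m (\<lambda>r. if r < k then w $ r else 0) + w $ k \<cdot>\<^sub>v unit_vec m k"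
          using Suc.prems by (intro eq_vecI) (auto simp: less_Suc_eq)
        then show ?case using Suc add smult all[of k] by simp
      qed
      from this[of m] have "vec m (\<lambda>r. if r < m then w $ r else 0) \<in> W" by simp
      also have "vec m (\<lambda>r. if r < m then w $ r else 0) = w" using w by (intro eq_vecI) auto
      finally show ?thesis .
    qed
    then show ?thesis using W(1) by blast
  qed simp
  moreover have "\<delta> \<cdot>\<^sub>m 1\<^sub>m m - A - B \<in> carrier_mat m m" "(1/2) \<cdot>\<^sub>m (A * B - B * A) \<in> carrier_mat m m"
    using A B by auto
  ultimately show ?thesis using A B m unfolding rep_irreducible_def rep_mats_def rep_of_def by simp
qed

section \<open>Cutting the triangular array to a finite intertwiner\<close>

definition upper_entry :: "bool \<Rightarrow> complex \<Rightarrow> nat \<Rightarrow> nat \<Rightarrow> complex" where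
  "upper_entry s x i j = (if i \<le> j then coef s x i (j - i) else 0)"

definition upper_mat :: "bool \<Rightarrow> complex \<Rightarrow> nat \<Rightarrow> complex mat" where
  "upper_mat s x d = mat (d + 1) (d + 1) (\<lambda>(i, j). upper_entry s x i j)"

text \<open>The function \<open>\<kappa>\<close> is the last-column correction produced by folding along the involution.\<close>

definition tri_mat :: "complex \<Rightarrow> nat \<Rightarrow> (nat \<Rightarrow> complex) \<Rightarrow> complex mat" where
  "tri_mat x d \<kappa> = mat (d + 1) (d + 1) (\<lambda>(i, j). tri x i j + (if j = d then \<kappa> i else 0))"

definition bdiag_mat :: "complex \<Rightarrow> nat \<Rightarrow> complex mat" where
  "bdiag_mat x d = mat (d + 1) (d + 1) (\<lambda>(i, j). if i = j then bdiag x i else 0)"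

definition low_mat :: "bool \<Rightarrow> complex \<Rightarrow> nat \<Rightarrow> complex mat" where
  "low_mat s x d = mat (d + 1) (d + 1) (\<lambda>(i, j).
     if i = j then adiag s x i else if i = j + 1 then 1 else 0)"

definition upp_mat :: "bool \<Rightarrow> complex \<Rightarrow> nat \<Rightarrow> complex mat" where
  "upp_mat s x d = mat (d + 1) (d + 1) (\<lambda>(i, j).
     if i = j then bdiag x i else if j = i + 1 then phi s x j else 0)"

lemma pair_carriers [simp]:
  "upper_mat s x d \<in> carrier_mat (d + 1) (d + 1)" "tri_mat x d \<kappa> \<in> carrier_mat (d + 1) (d + 1)"
  "bdiag_mat x d \<in> carrier_mat (d + 1) (d + 1)" "low_mat s x d \<in> carrier_mat (d + 1) (d + 1)"
  "upp_mat s x d \<in> carrier_mat (d + 1) (d + 1)"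
  by (simp_all add: upper_mat_def tri_mat_def bdiag_mat_def low_mat_def upp_mat_def)

text \<open>The relation for the infinite array, with no upper bound on the indices. On and above
  the diagonal it is \<open>coef_A\<close>, just below it \<open>coef_diag_Suc\<close>, and further
  down all terms vanish.\<close>

lemma upper_entry_A:
  "(if i = 0 then 0 else tri x i (i - 1) * upper_entry s x (i - 1) j) + tri x i i * upper_entry s x i j
     + tri x i (i + 1) * upper_entry s x (i + 1) j
   = adiag s x j * upper_entry s x i j + upper_entry s x i (j + 1)"
proof -
  consider "i \<le> j" | "i = Suc j" | "i > Suc j" by linarith
  then show ?thesis
  proof cases
    case 1
    then show ?thesis using coef_A[of i x s "j - i"]
      by (auto simp: upper_entry_def Suc_diff_le split: if_splits)
  next
    case 2
    then show ?thesis using coef_diag_Suc[of x j s] by (simp add: upper_entry_def)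
  qed (auto simp: upper_entry_def)
qed

lemma upper_entry_B:
  "bdiag x i * upper_entry s x i j = bdiag x j * upper_entry s x i j
     + (if j = 0 then 0 else phi s x j * upper_entry s x i (j - 1))"
proof -
  consider "i < j" | "i = j" | "i > j" by linarith
  then show ?thesis
  proof cases
    case 1
    define p where "p = j - i - 1"
    have j: "j = i + Suc p" using 1 by (simp add: p_def)
    show ?thesis using coef_B[of x i p s] unfolding j by (simp add: upper_entry_def algebra_simps)
  qed (auto simp: upper_entry_def)
qed

text \<open>Only the last column can fail: the infinite relation has the extra term
  \<open>upper_entry s x i (d + 1)\<close> there, and \<kappa> contributes \<kappa> i times the last
  diagonal entry. In earlier columns \<kappa> meets a zero of the triangular matrix.\<close>

lemma tri_mat_mult_upper:
  assumes \<kappa>: "\<And>i. i \<le> d \<Longrightarrow> \<kappa> i * coef s x d 0 + upper_entry s x i (d + 1) = 0"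
  shows "tri_mat x d \<kappa> * upper_mat s x d = upper_mat s x d * low_mat s x d"
proof (rule eq_matI)
  fix i j assume "i < dim_row (upper_mat s x d * low_mat s x d)" "j < dim_col (upper_mat s x d * low_mat s x d)"
  then have i: "i < d + 1" and j: "j < d + 1" by (auto simp: upper_mat_def low_mat_def)
  have "(tri_mat x d \<kappa> * upper_mat s x d) $$ (i, j)
      = (\<Sum>r = 0..<d + 1. (tri x i r + (if r = d then \<kappa> i else 0)) * upper_entry s x r j)"
    using i j by (simp add: tri_mat_def upper_mat_def scalar_prod_def)
  also have "\<dots> = (\<Sum>r = 0..<d + 1. tri x i r * upper_entry s x r j)
      + (\<Sum>r = 0..<d + 1. if r = d then \<kappa> i * upper_entry s x d j else 0)"
    by (subst sum.distrib[symmetric], rule sum.cong) (auto simp: algebra_simps)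
  also have "(\<Sum>r = 0..<d + 1. tri x i r * upper_entry s x r j)
      = (if i = 0 then 0 else tri x i (i - 1) * upper_entry s x (i - 1) j) + tri x i i * upper_entry s x i j
        + (if i + 1 < d + 1 then tri x i (i + 1) * upper_entry s x (i + 1) j else 0)"
    by (rule sum_tridiagonal[OF i]) (auto simp: tri_def)
  also have "(if i + 1 < d + 1 then tri x i (i + 1) * upper_entry s x (i + 1) j else 0)
      = tri x i (i + 1) * upper_entry s x (i + 1) j"
    using i j by (auto simp: upper_entry_def)
  also have "(\<Sum>r = 0..<d + 1. if r = d then \<kappa> i * upper_entry s x d j else 0) = \<kappa> i * upper_entry s x d j"
    by (simp add: sum.delta)
  finally have 1: "(tri_mat x d \<kappa> * upper_mat s x d) $$ (i, j)
      = adiag s x j * upper_entry s x i j + upper_entry s x i (j + 1) + \<kappa> i * upper_entry s x d j"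
    unfolding upper_entry_A .
  have "(upper_mat s x d * low_mat s x d) $$ (i, j)
      = (\<Sum>r = 0..<d + 1. upper_entry s x i r * (if r = j then adiag s x r else if r = j + 1 then 1 else 0))"
    using i j by (simp add: low_mat_def upper_mat_def scalar_prod_def)
  also have "\<dots> = (\<Sum>r = 0..<d + 1. if r = j then upper_entry s x i j * adiag s x j else 0)
      + (\<Sum>r = 0..<d + 1. if r = j + 1 then upper_entry s x i (j + 1) else 0)"
    by (subst sum.distrib[symmetric], rule sum.cong) auto
  also have "\<dots> = upper_entry s x i j * adiag s x j + (if j < d then upper_entry s x i (j + 1) else 0)"
    using j by (simp add: sum.delta)
  finally have 2: "(upper_mat s x d * low_mat s x d) $$ (i, j)
      = upper_entry s x i j * adiag s x j + (if j < d then upper_entry s x i (j + 1) else 0)" .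
  show "(tri_mat x d \<kappa> * upper_mat s x d) $$ (i, j) = (upper_mat s x d * low_mat s x d) $$ (i, j)"
  proof (cases "j < d")
    case False
    then have "j = d" using j by simp
    then show ?thesis using \<kappa>[of i] i unfolding 1 2 by (simp add: upper_entry_def algebra_simps)
  qed (simp add: 1 2 upper_entry_def)
qed (auto simp: tri_mat_def upper_mat_def low_mat_def)

lemma bdiag_mat_mult_upper: "bdiag_mat x d * upper_mat s x d = upper_mat s x d * upp_mat s x d"
proof (rule eq_matI)
  fix i j assume "i < dim_row (upper_mat s x d * upp_mat s x d)" "j < dim_col (upper_mat s x d * upp_mat s x d)"
  then have i: "i < d + 1" and j: "j < d + 1" by (auto simp: upper_mat_def upp_mat_def)
  have "(bdiag_mat x d * upper_mat s x d) $$ (i, j)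
      = (\<Sum>r = 0..<d + 1. (if i = r then bdiag x i else 0) * upper_entry s x r j)"
    using i j by (simp add: bdiag_mat_def upper_mat_def scalar_prod_def)
  also have "\<dots> = (\<Sum>r = 0..<d + 1. if r = i then bdiag x i * upper_entry s x i j else 0)"
    by (rule sum.cong) auto
  also have "\<dots> = bdiag x i * upper_entry s x i j" using i by (simp add: sum.delta)
  finally have 1: "(bdiag_mat x d * upper_mat s x d) $$ (i, j) = bdiag x i * upper_entry s x i j" .
  have "(upper_mat s x d * upp_mat s x d) $$ (i, j)
      = (\<Sum>r = 0..<d + 1. upper_entry s x i r * (if r = j then bdiag x r else if j = r + 1 then phi s x j else 0))"
    using i j by (simp add: upp_mat_def upper_mat_def scalar_prod_def)
  \<comment> \<open>For j = 0 the truncated \<open>j - 1\<close> would wrongly match r = 0, hence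
    the inner case distinction.\<close>
  also have "\<dots> = (\<Sum>r = 0..<d + 1. if r = j then upper_entry s x i j * bdiag x j else 0)
      + (\<Sum>r = 0..<d + 1. if r = j - 1 then if j = 0 then 0 else upper_entry s x i (j - 1) * phi s x j else 0)"
    by (subst sum.distrib[symmetric], rule sum.cong) auto
  also have "\<dots> = upper_entry s x i j * bdiag x j + (if j = 0 then 0 else upper_entry s x i (j - 1) * phi s x j)"
    using j by (auto simp: sum.delta)
  finally show "(bdiag_mat x d * upper_mat s x d) $$ (i, j) = (upper_mat s x d * upp_mat s x d) $$ (i, j)"
    unfolding 1 upper_entry_B by (simp add: mult.commute)
qed (auto simp: bdiag_mat_def upper_mat_def upp_mat_def)

lemma upper_mat_left_inverse:
  "\<exists>P \<in> carrier_mat (d + 1) (d + 1). P * upper_mat s x d = 1\<^sub>m (d + 1)"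
proof -
  have "det (upper_mat s x d) = prod_list (diag_mat (upper_mat s x d))"
    by (rule det_upper_triangular[OF _ pair_carriers(1)])
      (auto simp: upper_triangular_def upper_mat_def upper_entry_def)
  moreover have "0 \<notin> set (diag_mat (upper_mat s x d))"
    using coef_diag_nonzero[of s x] by (auto simp: diag_mat_def upper_mat_def upper_entry_def)
  ultimately have "det (upper_mat s x d) \<noteq> 0" by (simp add: prod_list_zero_iff)
  from det_non_zero_imp_unit[OF pair_carriers(1) this] show ?thesis
    by (auto simp: Units_def ring_mat_def)
qed

lemma tri_mat_similar:
  assumes "\<And>i. i \<le> d \<Longrightarrow> \<kappa> i * coef s x d 0 + upper_entry s x i (d + 1) = 0"
  shows "pair_similar (tri_mat x d \<kappa>) (bdiag_mat x d) (low_mat s x d) (upp_mat s x d)"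
  proof -
  obtain P where P: "P \<in> carrier_mat (d + 1) (d + 1)" "P * upper_mat s x d = 1\<^sub>m (d + 1)"
    using upper_mat_left_inverse by blast
  show ?thesis
    by (rule pair_similarI[OF pair_carriers(2,3,4,5,1) P
          tri_mat_mult_upper[OF assms] bdiag_mat_mult_upper])
qed

section \<open>The matrices of the even part of L_n\<close>

text \<open>Treats A (\<alpha> = \<beta> = 1) and C (\<alpha> = \<i>, \<beta> = -\<i>) together. X
  changes the parity of the index, so on even indices only X^2 - 4 remains, a sum over at most two
  odd intermediate indices.\<close>

lemma quadratic_entry:
  fixes \<alpha> \<beta> :: complex
  assumes X: "X \<in> carrier_mat (n + 1) (n + 1)"
    and Xe: "\<And>a b. a < n + 1 \<Longrightarrow> b < n + 1 \<Longrightarrow> X $$ (a, b)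
      = (if b = a + 1 then \<alpha> * (of_nat n - of_nat a) else if a = b + 1 then \<beta> * of_nat a else 0)"
    and i: "2 * i \<le> n" and j: "2 * j \<le> n"
  shows "((X - 2 \<cdot>\<^sub>m 1\<^sub>m (n + 1)) * (X + 2 \<cdot>\<^sub>m 1\<^sub>m (n + 1))) $$ (2 * i, 2 * j)
    = (if i = j then \<alpha> * \<beta> * ((of_nat n - 2 * of_nat i) * (2 * of_nat i + 1)
          + 2 * of_nat i * (of_nat n - 2 * of_nat i + 1)) - 4
       else if j = i + 1 then \<alpha>\<^sup>2 * (of_nat n - 2 * of_nat i) * (of_nat n - 2 * of_nat i - 1)
       else if i = j + 1 then \<beta>\<^sup>2 * (2 * of_nat i) * (2 * of_nat i - 1) else 0)"
proof -
  define f where "f = (\<lambda>a b. (if b = a + 1 then \<alpha> * (of_nat n - of_nat a)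
    else if a = b + 1 then \<beta> * of_nat a else 0))"
  define g where "g = (\<lambda>r. (f (2 * i) r - 2 * (if r = 2 * i then 1 else 0))
     * (f r (2 * j) + 2 * (if r = 2 * j then 1 else 0)))"
  have "((X - 2 \<cdot>\<^sub>m 1\<^sub>m (n + 1)) * (X + 2 \<cdot>\<^sub>m 1\<^sub>m (n + 1))) $$ (2 * i, 2 * j)
    = (\<Sum>r = 0..<n + 1. g r)"
    using i j X by (auto simp: scalar_prod_def Xe g_def f_def intro!: sum.cong)
  also have "\<dots> = (if 2 * i = 0 then 0 else g (2 * i - 1)) + g (2 * i)
      + (if 2 * i + 1 < n + 1 then g (2 * i + 1) else 0)"
    by (rule sum_tridiagonal) (use i in \<open>auto simp: g_def f_def\<close>)
  \<comment> \<open>If 2i = n, the neighbour 2i + 1 is out of range, but its term carries the factor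
    n - 2i = 0.\<close>
  also have "(if 2 * i + 1 < n + 1 then g (2 * i + 1) else 0) = g (2 * i + 1)"
  proof (cases "2 * i = n")
    case True
    then have "of_nat n = (2 * of_nat i :: complex)" by (metis of_nat_mult of_nat_numeral)
    then show ?thesis using True by (simp add: g_def f_def)
  qed (use i in auto)
  also have "g (2 * i + 1) = (if i = j then \<alpha> * \<beta> * (of_nat n - 2 * of_nat i) * (2 * of_nat i + 1)
      else if j = i + 1 then \<alpha>\<^sup>2 * (of_nat n - 2 * of_nat i) * (of_nat n - 2 * of_nat i - 1) else 0)"
  proof -
    have "2 * j \<noteq> 2 * i + 1" "2 * i + 1 \<noteq> 2 * j" by presburger+
    moreover have "2 * j = 2 * i + 1 + 1 \<longleftrightarrow> j = i + 1" by auto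
    ultimately show ?thesis by (simp add: g_def f_def power2_eq_square algebra_simps)
  qed
  also have "g (2 * i) = (if i = j then - 4 else 0)"
  proof -
    have "2 * j \<noteq> 2 * i + 1" "2 * i \<noteq> 2 * j + 1" by presburger+
    then show ?thesis by (simp add: g_def f_def)
  qed
  also have "(if 2 * i = 0 then 0 else g (2 * i - 1))
      = (if i = j then \<alpha> * \<beta> * (2 * of_nat i) * (of_nat n - 2 * of_nat i + 1)
        else if i = j + 1 then \<beta>\<^sup>2 * (2 * of_nat i) * (2 * of_nat i - 1) else 0)"
  proof (cases i)
    case (Suc a)
    have "2 * j \<noteq> 2 * a + 1" "2 * a + 1 \<noteq> 2 * j" by presburger+
    moreover have "2 * a + 1 = 2 * j + 1 \<longleftrightarrow> a = j" "2 * j = 2 * a + 1 + 1 \<longleftrightarrow> j = Suc a" by auto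
    moreover have "2 * i - 1 = 2 * a + 1" using Suc by simp
    ultimately show ?thesis using Suc
      by (cases "j = Suc a") (simp_all add: g_def f_def power2_eq_square algebra_simps)
  qed simp
  finally show ?thesis by (simp add: algebra_simps)
qed

lemma E_entry: "a < n + 1 \<Longrightarrow> b < n + 1 \<Longrightarrow>
    E_mat n $$ (a, b) = (if b = a + 1 then of_nat n - of_nat a else 0)"
  by (simp add: E_mat_def of_nat_diff)

lemma F_entry: "a < n + 1 \<Longrightarrow> b < n + 1 \<Longrightarrow>
    F_mat n $$ (a, b) = (if a = b + 1 then of_nat a else 0)"
  by (simp add: F_mat_def)

lemma H_entry: "a < n + 1 \<Longrightarrow> b < n + 1 \<Longrightarrow>
    H_mat n $$ (a, b) = (if a = b then of_nat n - 2 * of_nat a else 0)"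
  by (simp add: H_mat_def)

lemma EFH_carrier [simp]:
  "E_mat n \<in> carrier_mat (n + 1) (n + 1)" "F_mat n \<in> carrier_mat (n + 1) (n + 1)"
  "H_mat n \<in> carrier_mat (n + 1) (n + 1)"
  by (simp_all add: E_mat_def F_mat_def H_mat_def)

lemma EE_entry:
  assumes i: "2 * i \<le> n" and j: "2 * j \<le> n"
  shows "(E_mat n * E_mat n) $$ (2 * i, 2 * j)
    = (if j = i + 1 then (of_nat n - 2 * of_nat i) * (of_nat n - 2 * of_nat i - 1) else 0)"
proof -
  have "(E_mat n * E_mat n) $$ (2 * i, 2 * j) = (\<Sum>r = 0..<n + 1. E_mat n $$ (2 * i, r) * E_mat n $$ (r, 2 * j))"
    using i j by (simp add: scalar_prod_def E_mat_def)
  also have "\<dots> = (\<Sum>r = 0..<n + 1. if r = 2 * i + 1 then if j = i + 1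
      then (of_nat n - 2 * of_nat i) * (of_nat n - 2 * of_nat i - 1) else 0 else 0)"
    by (rule sum.cong) (use i j in \<open>auto simp: E_entry algebra_simps\<close>)
  also have "\<dots> = (if j = i + 1 then (of_nat n - 2 * of_nat i) * (of_nat n - 2 * of_nat i - 1) else 0)"
    using j by (auto simp: sum.delta)
  finally show ?thesis .
qed

lemma FF_entry:
  assumes i: "2 * i \<le> n" and j: "2 * j \<le> n"
  shows "(F_mat n * F_mat n) $$ (2 * i, 2 * j)
    = (if i = j + 1 then 2 * of_nat i * (2 * of_nat i - 1) else 0)"
proof -
  have "(F_mat n * F_mat n) $$ (2 * i, 2 * j) = (\<Sum>r = 0..<n + 1. F_mat n $$ (2 * i, r) * F_mat n $$ (r, 2 * j))"
    using i j by (simp add: scalar_prod_def F_mat_def)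
  also have "\<dots> = (\<Sum>r = 0..<n + 1. if r = 2 * j + 1 then if i = j + 1
      then 2 * of_nat i * (2 * of_nat i - 1) else 0 else 0)"
    by (rule sum.cong) (use i j in \<open>auto simp: F_entry algebra_simps\<close>)
  also have "\<dots> = (if i = j + 1 then 2 * of_nat i * (2 * of_nat i - 1) else 0)"
    using i by (auto simp: sum.delta)
  finally show ?thesis .
qed

lemma diagonal_mult_entry:
  assumes M: "M \<in> carrier_mat m m" and N: "N \<in> carrier_mat m m" and i: "i < m" and j: "j < m"
    and diag: "\<And>a b. a < m \<Longrightarrow> b < m \<Longrightarrow> M $$ (a, b) = (if a = b then t a else (0 :: 'a :: comm_semiring_1))"
  shows "(M * N) $$ (i, j) = t i * N $$ (i, j)"
proof -
  have "(M * N) $$ (i, j) = (\<Sum>r = 0..<m. M $$ (i, r) * N $$ (r, j))"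
    using assms by (simp add: scalar_prod_def)
  also have "\<dots> = (\<Sum>r = 0..<m. if r = i then t i * N $$ (i, j) else 0)"
    by (rule sum.cong) (use i diag in auto)
  finally show ?thesis using i by simp
qed

lemma mult_diagonal_entry:
  assumes M: "M \<in> carrier_mat m m" and N: "N \<in> carrier_mat m m" and i: "i < m" and j: "j < m"
    and diag: "\<And>a b. a < m \<Longrightarrow> b < m \<Longrightarrow> M $$ (a, b) = (if a = b then t a else (0 :: 'a :: comm_semiring_1))"
  shows "(N * M) $$ (i, j) = t j * N $$ (i, j)"
proof -
  have "(N * M) $$ (i, j) = (\<Sum>r = 0..<m. N $$ (i, r) * M $$ (r, j))"
    using assms by (simp add: scalar_prod_def)
  also have "\<dots> = (\<Sum>r = 0..<m. if r = j then t j * N $$ (i, j) else 0)"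
    by (rule sum.cong) (use j diag in \<open>auto simp: mult.commute\<close>)
  finally show ?thesis using j by simp
qed

text \<open>The scalar is the value of \<delta>: A + B + C is the image of (H^2 + 2EF + 2FE -
  12)/16, and the Casimir element H^2 + 2EF + 2FE acts on L_n as n(n+2) = 4x^2 + 4x. As B is
  diagonal, the commutator with A is computed entry by entry.\<close>

lemma L0_rep_eq:
  fixes n :: nat
  defines "x \<equiv> of_nat n / 2" and "h \<equiv> n div 2"
  shows "L0_rep n = rep_of (h + 1) ((x\<^sup>2 + x - 3) / 4) (tri_mat x h (\<lambda>_. 0)) (bdiag_mat x h)"
proof -
  let ?T = "tri_mat x h (\<lambda>_. 0)" and ?D = "bdiag_mat x h"
  have n: "of_nat n = 2 * x" by (simp add: x_def)
  have le: "2 * i \<le> n" if "i < h + 1" for i using that by (simp add: h_def)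
  have T: "?T $$ (i, j) = tri x i j" and D: "?D $$ (i, j) = (if i = j then bdiag x i else 0)"
    if "i < h + 1" "j < h + 1" for i j using that by (auto simp: tri_mat_def bdiag_mat_def)
  note c = EFH_carrier[of n]
  have d: "dim_row (E_mat n) = n + 1" "dim_col (E_mat n) = n + 1" "dim_row (F_mat n) = n + 1"
    "dim_col (F_mat n) = n + 1" "dim_row (H_mat n) = n + 1" "dim_col (H_mat n) = n + 1"
    using c by auto
  have SA: "sharpA n $$ (2 * i, 2 * j) = tri x i j" if ij: "i < h + 1" "j < h + 1" for i j
  proof -
    let ?S = "E_mat n + F_mat n"
    have S: "?S \<in> carrier_mat (n + 1) (n + 1)" by (rule add_carrier_mat[OF c(2)])
    have "sharpA n $$ (2 * i, 2 * j)
        = 1/16 * ((?S - 2 \<cdot>\<^sub>m 1\<^sub>m (n + 1)) * (?S + 2 \<cdot>\<^sub>m 1\<^sub>m (n + 1))) $$ (2 * i, 2 * j)"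
      unfolding sharpA_def Let_def using le[OF ij(1)] le[OF ij(2)] S by (subst index_smult_mat) (auto simp: d)
    also have "\<dots> = 1/16 * (if i = j then 1 * 1 * ((of_nat n - 2 * of_nat i) * (2 * of_nat i + 1)
          + 2 * of_nat i * (of_nat n - 2 * of_nat i + 1)) - 4
       else if j = i + 1 then 1\<^sup>2 * (of_nat n - 2 * of_nat i) * (of_nat n - 2 * of_nat i - 1)
       else if i = j + 1 then 1\<^sup>2 * (2 * of_nat i) * (2 * of_nat i - 1) else 0)"
      by (subst quadratic_entry[OF S _ le[OF ij(1)] le[OF ij(2)], where \<alpha> = 1 and \<beta> = 1])
        (auto simp: E_entry F_entry d)
    also have "\<dots> = tri x i j"
      unfolding n by (auto simp: tri_def power2_eq_square field_simps)
    finally show ?thesis .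
  qed
  have SB: "sharpB n $$ (2 * i, 2 * j) = (if i = j then bdiag x i else 0)"
    if ij: "i < h + 1" "j < h + 1" for i j
  proof -
    let ?M = "H_mat n - 2 \<cdot>\<^sub>m 1\<^sub>m (n + 1)" and ?N = "H_mat n + 2 \<cdot>\<^sub>m 1\<^sub>m (n + 1)"
    have MN: "?M \<in> carrier_mat (n + 1) (n + 1)" "?N \<in> carrier_mat (n + 1) (n + 1)"
      by (rule carrier_matI; simp)+
    have "sharpB n $$ (2 * i, 2 * j) = 1/16 * (?M * ?N) $$ (2 * i, 2 * j)"
      unfolding sharpB_def Let_def using le[OF ij(1)] le[OF ij(2)] by (subst index_smult_mat) (auto simp: d)
    also have "(?M * ?N) $$ (2 * i, 2 * j)
        = (of_nat n - 2 * of_nat (2 * i) - 2) * ?N $$ (2 * i, 2 * j)"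
      by (rule diagonal_mult_entry[OF MN, where t = "\<lambda>a. of_nat n - 2 * of_nat a - 2"])
        (use le[OF ij(1)] le[OF ij(2)] in \<open>auto simp: H_entry d\<close>)
    also have "?N $$ (2 * i, 2 * j) = (if i = j then of_nat n - 4 * of_nat i + 2 else 0)"
      using le[OF ij(1)] le[OF ij(2)] by (auto simp: H_entry d)
    finally show ?thesis unfolding n by (cases "i = j") (simp_all add: bdiag_def power2_eq_square field_simps)
  qed
  have SC: "sharpC n $$ (2 * i, 2 * j) = (if i = j then (x\<^sup>2 + x - 3) / 4 else 0)
      - tri x i j - (if i = j then bdiag x i else 0)" if ij: "i < h + 1" "j < h + 1" for i j
  proof -
    let ?S = "\<i> \<cdot>\<^sub>m E_mat n - \<i> \<cdot>\<^sub>m F_mat n"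
    have S: "?S \<in> carrier_mat (n + 1) (n + 1)" by (rule carrier_matI) (auto simp: d)
    have "sharpC n $$ (2 * i, 2 * j)
        = 1/16 * ((?S - 2 \<cdot>\<^sub>m 1\<^sub>m (n + 1)) * (?S + 2 \<cdot>\<^sub>m 1\<^sub>m (n + 1))) $$ (2 * i, 2 * j)"
      unfolding sharpC_def Let_def using le[OF ij(1)] le[OF ij(2)] S by (subst index_smult_mat) (auto simp: d)
    also have "\<dots> = 1/16 * (if i = j then \<i> * (- \<i>) * ((of_nat n - 2 * of_nat i) * (2 * of_nat i + 1)
          + 2 * of_nat i * (of_nat n - 2 * of_nat i + 1)) - 4
       else if j = i + 1 then \<i>\<^sup>2 * (of_nat n - 2 * of_nat i) * (of_nat n - 2 * of_nat i - 1)
       else if i = j + 1 then (- \<i>)\<^sup>2 * (2 * of_nat i) * (2 * of_nat i - 1) else 0)"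
      by (subst quadratic_entry[OF S _ le[OF ij(1)] le[OF ij(2)], where \<alpha> = \<i> and \<beta> = "- \<i>"])
        (auto simp: E_entry F_entry d)
    also have "\<dots> = (if i = j then (x\<^sup>2 + x - 3) / 4 else 0)
      - tri x i j - (if i = j then bdiag x i else 0)"
      unfolding n by (auto simp: tri_def bdiag_def power2_eq_square field_simps)
    finally show ?thesis .
  qed
  have SD: "sharpDelta n $$ (2 * i, 2 * j) = (1/2) * (tri x i j * (bdiag x j - bdiag x i))"
    if ij: "i < h + 1" "j < h + 1" for i j
  proof -
    let ?M = "H_mat n - 2 \<cdot>\<^sub>m 1\<^sub>m (n + 1)" and ?N = "H_mat n + 2 \<cdot>\<^sub>m 1\<^sub>m (n + 1)"
    have MN: "?M \<in> carrier_mat (n + 1) (n + 1)" "?N \<in> carrier_mat (n + 1) (n + 1)"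
      by (rule carrier_matI; simp)+
    note EE = mult_carrier_mat[OF c(1) c(1)] and FF = mult_carrier_mat[OF c(2) c(2)]
    have "sharpDelta n $$ (2 * i, 2 * j)
        = 1/64 * ((?N * (F_mat n * F_mat n)) $$ (2 * i, 2 * j) - (?M * (E_mat n * E_mat n)) $$ (2 * i, 2 * j))"
      unfolding sharpDelta_def Let_def using le[OF ij(1)] le[OF ij(2)]
      by (subst index_smult_mat, simp add: d, simp add: d, subst index_minus_mat) (auto simp: d)
    also have "(?N * (F_mat n * F_mat n)) $$ (2 * i, 2 * j)
        = (of_nat n - 2 * of_nat (2 * i) + 2) * (F_mat n * F_mat n) $$ (2 * i, 2 * j)"
      by (rule diagonal_mult_entry[OF MN(2) FF, where t = "\<lambda>a. of_nat n - 2 * of_nat a + 2"])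
        (use le[OF ij(1)] le[OF ij(2)] in \<open>auto simp: H_entry d\<close>)
    also have "(?M * (E_mat n * E_mat n)) $$ (2 * i, 2 * j)
        = (of_nat n - 2 * of_nat (2 * i) - 2) * (E_mat n * E_mat n) $$ (2 * i, 2 * j)"
      by (rule diagonal_mult_entry[OF MN(1) EE, where t = "\<lambda>a. of_nat n - 2 * of_nat a - 2"])
        (use le[OF ij(1)] le[OF ij(2)] in \<open>auto simp: H_entry d\<close>)
    also have "1/64 * ((of_nat n - 2 * of_nat (2 * i) + 2) * (F_mat n * F_mat n) $$ (2 * i, 2 * j)
        - (of_nat n - 2 * of_nat (2 * i) - 2) * (E_mat n * E_mat n) $$ (2 * i, 2 * j))
        = (1/2) * (tri x i j * (bdiag x j - bdiag x i))"
      unfolding EE_entry[OF le[OF ij(1)] le[OF ij(2)]] FF_entry[OF le[OF ij(1)] le[OF ij(2)]] n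
      by (auto simp: tri_def bdiag_def power2_eq_square field_simps)
    finally show ?thesis .
  qed
  have TD: "(?T * ?D - ?D * ?T) $$ (i, j) = tri x i j * (bdiag x j - bdiag x i)"
    if ij: "i < h + 1" "j < h + 1" for i j
  proof -
    have "(?T * ?D - ?D * ?T) $$ (i, j) = (?T * ?D) $$ (i, j) - (?D * ?T) $$ (i, j)"
      using ij by (subst index_minus_mat) (auto simp: tri_mat_def bdiag_mat_def)
    also have "(?T * ?D) $$ (i, j) = bdiag x j * ?T $$ (i, j)"
      by (rule mult_diagonal_entry[OF pair_carriers(3) pair_carriers(2) ij D])
    also have "(?D * ?T) $$ (i, j) = bdiag x i * ?T $$ (i, j)"
      by (rule diagonal_mult_entry[OF pair_carriers(3) pair_carriers(2) ij D])
    finally show ?thesis using T[OF ij] by (simp add: algebra_simps)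
  qed
  have dims: "dim_row ?T = h + 1" "dim_col ?T = h + 1" "dim_row ?D = h + 1" "dim_col ?D = h + 1"
    by (auto simp: tri_mat_def bdiag_mat_def)
  have 1: "even_part n (sharpA n) = ?T"
    by (rule eq_matI) (use SA T in \<open>auto simp: even_part_def even_dim_def dims simp flip: h_def\<close>)
  have 2: "even_part n (sharpB n) = ?D"
    by (rule eq_matI) (use SB D in \<open>auto simp: even_part_def even_dim_def dims simp flip: h_def\<close>)
  have 3: "even_part n (sharpC n) = ((x\<^sup>2 + x - 3) / 4) \<cdot>\<^sub>m 1\<^sub>m (h + 1) - ?T - ?D"
    by (rule eq_matI) (use SC D T in \<open>auto simp: even_part_def even_dim_def dims simp flip: h_def\<close>)
  have 4: "even_part n (sharpDelta n) = (1/2) \<cdot>\<^sub>m (?T * ?D - ?D * ?T)"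
  proof (rule eq_matI)
    fix i j assume "i < dim_row ((1/2) \<cdot>\<^sub>m (?T * ?D - ?D * ?T))" "j < dim_col ((1/2) \<cdot>\<^sub>m (?T * ?D - ?D * ?T))"
    then have ij: "i < h + 1" "j < h + 1" by (auto simp: dims)
    have "((1/2) \<cdot>\<^sub>m (?T * ?D - ?D * ?T)) $$ (i, j) = 1/2 * (?T * ?D - ?D * ?T) $$ (i, j)"
      by (rule index_smult_mat) (use ij in \<open>auto simp: dims\<close>)
    then show "even_part n (sharpDelta n) $$ (i, j) = ((1/2) \<cdot>\<^sub>m (?T * ?D - ?D * ?T)) $$ (i, j)"
      using ij unfolding TD[OF ij] by (simp add: even_part_def even_dim_def SD[OF ij] flip: h_def)
  qed (auto simp: even_part_def even_dim_def dims simp flip: h_def)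
  show ?thesis unfolding L0_rep_def rep_of_def 1 2 3 4 ..
qed

section \<open>Vectors symmetric or antisymmetric under reflection of the index\<close>

definition fold_entry :: "complex \<Rightarrow> nat \<Rightarrow> nat \<Rightarrow> nat \<Rightarrow> complex" where
  "fold_entry e h i j = (if i = j then 1 else 0) + e * (if i + j = h then 1 else 0)"

text \<open>At a fixed index 2c = h both terms are present and the entry is 1 + e, so the middle
  symmetric vector is twice a basis vector.\<close>

lemma fold_sum:
  assumes "c \<le> h"
  shows "(\<Sum>i = 0..<h + 1. fold_entry e h i c * f i) = f c + e * f (h - c)"
proof -
  have "(\<Sum>i = 0..<h + 1. fold_entry e h i c * f i)
    = (\<Sum>i = 0..<h + 1. if i = c then f c else 0) + (\<Sum>i = 0..<h + 1. if i = h - c then e * f (h - c) else 0)"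
    unfolding sum.distrib[symmetric]
    by (rule sum.cong) (use assms in \<open>auto simp: fold_entry_def distrib_right\<close>)
  then show ?thesis using assms by (simp add: sum.delta)
qed

text \<open>The columns of the folding matrix are v_c + e v_{h-c}. Assumption \<open>sym\<close>
  says that f commutes with the reflection; the right side of \<open>fold\<close> lets rows beyond d
  be filled from their mirror images.\<close>

lemma fold_intertwines:
  assumes d: "d \<le> h"
    and sym: "\<And>i c. i \<le> h \<Longrightarrow> c \<le> d \<Longrightarrow> f i (h - c) = f (h - i) c"
    and fold: "\<And>i c. i \<le> h \<Longrightarrow> c \<le> d \<Longrightarrow> f i c + e * f (h - i) c
      = (if i \<le> d then t i c else 0) + e * (if h - i \<le> d then t (h - i) c else 0)"
  shows "mat (h + 1) (h + 1) (\<lambda>(i, j). f i j) * mat (h + 1) (d + 1) (\<lambda>(i, j). fold_entry e h i j)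
    = mat (h + 1) (d + 1) (\<lambda>(i, j). fold_entry e h i j) * mat (d + 1) (d + 1) (\<lambda>(i, j). t i j)"
    (is "?L * ?S = ?S * ?T")
proof (rule eq_matI)
  fix i c assume "i < dim_row (?S * ?T)" "c < dim_col (?S * ?T)"
  then have i: "i \<le> h" and c: "c \<le> d" by auto
  have "(?L * ?S) $$ (i, c) = (\<Sum>r = 0..<h + 1. fold_entry e h r c * f i r)"
    using i c by (simp add: scalar_prod_def mult.commute)
  also have "\<dots> = f i c + e * f (h - i) c" using fold_sum[of c h] c d i sym by simp
  finally have 1: "(?L * ?S) $$ (i, c) = f i c + e * f (h - i) c" .
  have "(?S * ?T) $$ (i, c) = (\<Sum>r = 0..<d + 1. fold_entry e h i r * t r c)"
    using i c by (simp add: scalar_prod_def)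
  also have "\<dots> = (\<Sum>r = 0..<d + 1. if r = i then t i c else 0)
      + (\<Sum>r = 0..<d + 1. if r = h - i then e * t (h - i) c else 0)"
    unfolding sum.distrib[symmetric]
    by (rule sum.cong) (use i d in \<open>auto simp: fold_entry_def distrib_right\<close>)
  also have "\<dots> = (if i \<le> d then t i c else 0) + e * (if h - i \<le> d then t (h - i) c else 0)"
    by (auto simp: sum.delta less_Suc_eq_le)
  finally show "(?L * ?S) $$ (i, c) = (?S * ?T) $$ (i, c)" using 1 fold[OF i c] by simp
qed auto

lemma mult_blockdiag_columns:
  fixes L :: "complex mat"
  assumes L: "L \<in> carrier_mat (k + l) (k + l)" and S1: "S1 \<in> carrier_mat (k + l) k"
    and S2: "S2 \<in> carrier_mat (k + l) l" and T1: "T1 \<in> carrier_mat k k" and T2: "T2 \<in> carrier_mat l l"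
    and 1: "L * S1 = S1 * T1" and 2: "L * S2 = S2 * T2"
  defines "G \<equiv> mat (k + l) (k + l) (\<lambda>(i, c). if c < k then S1 $$ (i, c) else S2 $$ (i, c - k))"
  shows "L * G = G * blockdiag k l T1 T2"
proof (rule eq_matI)
  fix i c assume "i < dim_row (G * blockdiag k l T1 T2)" "c < dim_col (G * blockdiag k l T1 T2)"
  then have i: "i < k + l" and c: "c < k + l" using T1 T2 by (auto simp: G_def blockdiag_def)
  have LG: "(L * G) $$ (i, c) = (\<Sum>r = 0..<k + l. L $$ (i, r) * (if c < k then S1 $$ (r, c) else S2 $$ (r, c - k)))"
    using i c L by (auto simp: scalar_prod_def G_def)
  have "(G * blockdiag k l T1 T2) $$ (i, c)
    = (\<Sum>r = 0..<k + l. G $$ (i, r) * blockdiag k l T1 T2 $$ (r, c))"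
    using i c T1 T2 by (simp add: scalar_prod_def G_def blockdiag_def)
  also have "\<dots> = (\<Sum>r = 0..<k. G $$ (i, r) * blockdiag k l T1 T2 $$ (r, c))
     + (\<Sum>r = 0..<l. G $$ (i, r + k) * blockdiag k l T1 T2 $$ (r + k, c))"
    using sum.atLeastLessThan_concat[of 0 k "k + l" "\<lambda>r. G $$ (i, r) * blockdiag k l T1 T2 $$ (r, c)"]
      sum.shift_bounds_nat_ivl[of "\<lambda>r. G $$ (i, r) * blockdiag k l T1 T2 $$ (r, c)" 0 k l]
    by (simp add: add.commute)
  also have "(\<Sum>r = 0..<k. G $$ (i, r) * blockdiag k l T1 T2 $$ (r, c))
      = (if c < k then (S1 * T1) $$ (i, c) else 0)"
    using i c T1 T2 S1 by (auto simp: G_def blockdiag_def scalar_prod_def intro!: sum.cong)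
  also have "(\<Sum>r = 0..<l. G $$ (i, r + k) * blockdiag k l T1 T2 $$ (r + k, c))
      = (if c < k then 0 else (S2 * T2) $$ (i, c - k))"
    using i c T1 T2 S2 by (auto simp: G_def blockdiag_def scalar_prod_def intro!: sum.cong)
  finally have GB: "(G * blockdiag k l T1 T2) $$ (i, c)
      = (if c < k then (L * S1) $$ (i, c) else (L * S2) $$ (i, c - k))"
    unfolding 1 2 by simp
  show "(L * G) $$ (i, c) = (G * blockdiag k l T1 T2) $$ (i, c)"
    unfolding LG GB using i c L S1 S2 by (auto simp: scalar_prod_def)
qed (use L T1 T2 in \<open>auto simp: G_def blockdiag_def\<close>)

section \<open>Folding along the involution\<close>

lemma tri_far: "j + 1 < i \<or> i + 1 < j \<Longrightarrow> tri x i j = 0"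
  by (auto simp: tri_def)

text \<open>At x = h the reflection exchanges the superdiagonal and subdiagonal formulas of
  \<open>tri\<close> and fixes the diagonal one. Both sides vanish unless i + c differs from h by at
  most 1.\<close>

lemma tri_reflect:
  assumes "i \<le> h" "c \<le> h"
  shows "tri (of_nat h) i (h - c) = tri (of_nat h) (h - i) c"
proof -
  consider "i + c = h" | "i + c = h + 1" | "i + c + 1 = h" | "i + c > h + 1" | "i + c + 1 < h" by linarith
  then show ?thesis
  proof cases
    case 1
    then have "h - c = i" "h - i = c" and h: "of_nat h = (of_nat i + of_nat c :: complex)"
      by (auto simp flip: of_nat_add)
    then show ?thesis by (simp add: tri_def power2_eq_square algebra_simps)
  next
    case 2
    then obtain a where i: "i = Suc a" by (cases i) (use assms in auto)
    then have hc: "h - c = a" "c = Suc (h - i)" and h: "of_nat h = (of_nat a + of_nat c :: complex)"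
      using 2 assms by (auto simp flip: of_nat_add)
    have c: "of_nat (h - i) = (of_nat c - 1 :: complex)" using hc(2) by (metis add_diff_cancel_left' of_nat_Suc)
    have "tri (of_nat h) i (h - c) = (of_nat a + 1/2) * (of_nat a + 1) / 4"
      unfolding hc(1) i by (simp add: tri_def)
    also have "\<dots> = (of_nat h - of_nat (h - i) - 1/2) * (of_nat h - of_nat (h - i)) / 4"
      unfolding c h by (simp add: field_simps)
    also have "\<dots> = tri (of_nat h) (h - i) c" using hc(2) by (simp add: tri_def)
    finally show ?thesis .
  next
    case 3
    then have hc: "h - c = Suc i" "h - i = Suc c" and h: "of_nat h = (of_nat i + of_nat c + 1 :: complex)"
      by auto
    then show ?thesis by (simp add: tri_def field_simps)
  next
    case 4
    then have "h - c + 1 < i" "h - i + 1 < c" using assms by linarith+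
    then show ?thesis by (simp add: tri_far)
  next
    case 5
    then have "i + 1 < h - c" "c + 1 < h - i" using assms by linarith+
    then show ?thesis by (simp add: tri_far)
  qed
qed

lemma bdiag_reflect: "i \<le> h \<Longrightarrow> bdiag (of_nat h) (h - i) = bdiag (of_nat h) i"
  by (simp add: bdiag_def of_nat_diff power2_eq_square field_simps)

text \<open>The size conditions force d2 to be h/2 rounded down and d1 + 1 to be h/2 rounded up: d1
  + 1 antisymmetric and d2 + 1 symmetric vectors, a possible middle index being counted among the
  symmetric ones.\<close>

lemma fold_similar:
  fixes h d1 d2 :: nat and \<kappa> :: "complex \<Rightarrow> nat \<Rightarrow> complex"
  defines "x \<equiv> of_nat h"
  defines "d e \<equiv> (if e = (1 :: complex) then d2 else d1)"
  assumes h: "d1 + d2 + 1 = h" "2 * d1 + 1 \<le> h" "2 * d2 \<le> h"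
    and \<kappa>: "\<And>e i c. e \<in> {-1, 1} \<Longrightarrow> i \<le> h \<Longrightarrow> c \<le> d e \<Longrightarrow>
      tri x i c + e * tri x (h - i) c
      = (if i \<le> d e then tri x i c + (if c = d e then \<kappa> e i else 0) else 0)
        + e * (if h - i \<le> d e then tri x (h - i) c + (if c = d e then \<kappa> e (h - i) else 0) else 0)"
  shows "pair_similar (tri_mat x h (\<lambda>_. 0)) (bdiag_mat x h)
    (blockdiag (d1 + 1) (d2 + 1) (tri_mat x d1 (\<kappa> (-1))) (tri_mat x d2 (\<kappa> 1)))
    (blockdiag (d1 + 1) (d2 + 1) (bdiag_mat x d1) (bdiag_mat x d2))"
proof -
  define S where "S = (\<lambda>e. mat (h + 1) (d e + 1) (\<lambda>(i, j). fold_entry e h i j))"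
  define k l where "k = d1 + 1" and "l = d2 + 1"
  have kl: "k + l = h + 1" using h by (simp add: k_def l_def)
  have d: "d (-1) = d1" "d 1 = d2" by (auto simp: d_def)
  have dh: "d e \<le> h" for e using h by (auto simp: d_def)
  have T: "tri_mat x h (\<lambda>_. 0) * S e = S e * tri_mat x (d e) (\<kappa> e)" if "e \<in> {-1, 1}" for e
  proof -
    have "tri_mat x h (\<lambda>_. 0) = mat (h + 1) (h + 1) (\<lambda>(i, j). tri x i j)" by (simp add: tri_mat_def)
    then show ?thesis unfolding S_def tri_mat_def[of x "d e"]
      using fold_intertwines[of "d e" h "tri x" e "\<lambda>i j. tri x i j + (if j = d e then \<kappa> e i else 0)"]
        \<kappa>[OF that] dh[of e] tri_reflect by (simp add: x_def)
  qed
  have D: "bdiag_mat x h * S e = S e * bdiag_mat x (d e)" for e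
    unfolding S_def bdiag_mat_def
    by (rule fold_intertwines[OF dh]) (use dh[of e] in \<open>auto simp: bdiag_reflect x_def\<close>)
  define G where "G = mat (k + l) (k + l) (\<lambda>(i, c). if c < k then S (-1) $$ (i, c) else S 1 $$ (i, c - k))"
  have carr: "tri_mat x h (\<lambda>_. 0) \<in> carrier_mat (k + l) (k + l)" "bdiag_mat x h \<in> carrier_mat (k + l) (k + l)"
    "S (-1) \<in> carrier_mat (k + l) k" "S 1 \<in> carrier_mat (k + l) l"
    "tri_mat x d1 (\<kappa> (-1)) \<in> carrier_mat k k" "tri_mat x d2 (\<kappa> 1) \<in> carrier_mat l l"
    "bdiag_mat x d1 \<in> carrier_mat k k" "bdiag_mat x d2 \<in> carrier_mat l l"
    unfolding kl by (auto simp: tri_mat_def bdiag_mat_def S_def k_def l_def d)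
  have TG: "tri_mat x h (\<lambda>_. 0) * G = G * blockdiag k l (tri_mat x d1 (\<kappa> (-1))) (tri_mat x d2 (\<kappa> 1))"
    unfolding G_def
    by (rule mult_blockdiag_columns[OF carr(1,3,4,5,6)]) (use T[of "-1"] T[of 1] d in auto)
  have DG: "bdiag_mat x h * G = G * blockdiag k l (bdiag_mat x d1) (bdiag_mat x d2)"
    unfolding G_def
    by (rule mult_blockdiag_columns[OF carr(2,3,4,7,8)]) (use D[of "-1"] D[of 1] d in auto)
  define sg :: "nat \<Rightarrow> complex" where "sg c = (if c < k then -1 else 1)" for c
  define ix where "ix c = (if c < k then c else c - k)" for c
  \<comment> \<open>The columns of G are orthogonal of squared norm 2, except that the middle
    symmetric column, with the single entry 2, has squared norm 4. The inverse is therefore the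
    transpose with rows scaled by 1/2 or 1/4.\<close>
  define w :: "nat \<Rightarrow> complex" where "w c = (if \<not> c < k \<and> 2 * ix c = h then 1/4 else 1/2)" for c
  have G: "G $$ (i, c) = fold_entry (sg c) h i (ix c)" if "i < k + l" "c < k + l" for i c
    using that kl by (auto simp: G_def S_def sg_def ix_def d k_def l_def)
  define P where "P = mat (k + l) (k + l) (\<lambda>(c, i). w c * G $$ (i, c))"
  have "P * G = 1\<^sub>m (k + l)"
  proof (rule eq_matI)
    fix c c' assume "c < dim_row (1\<^sub>m (k + l))" "c' < dim_col (1\<^sub>m (k + l))"
    then have c: "c < k + l" "c' < k + l" by auto
    have ix: "ix c \<le> h" "ix c' \<le> h" using c kl by (auto simp: ix_def)
    have "(P * G) $$ (c, c') = (\<Sum>i = 0..<k + l. w c * G $$ (i, c) * G $$ (i, c'))"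
      using c by (simp add: P_def G_def scalar_prod_def)
    also have "\<dots> = w c * (\<Sum>i = 0..<h + 1. fold_entry (sg c) h i (ix c) * fold_entry (sg c') h i (ix c'))"
      unfolding sum_distrib_left kl[symmetric] by (rule sum.cong) (use c in \<open>auto simp: G\<close>)
    also have "\<dots> = w c * (fold_entry (sg c') h (ix c) (ix c') + sg c * fold_entry (sg c') h (h - ix c) (ix c'))"
      by (simp only: fold_sum[OF ix(1)])
    also have "\<dots> = (if c = c' then 1 else 0)"
    proof -
      have bounds: "2 * ix c < h" if "c < k" for c using that h by (auto simp: ix_def k_def)
      have bounds2: "2 * ix c \<le> h" if "\<not> c < k" "c < k + l" for c
        using that h by (auto simp: ix_def k_def l_def)
      have inj: "ix c = ix c' \<longleftrightarrow> c = c'" if "c < k \<longleftrightarrow> c' < k" using that by (auto simp: ix_def)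
      have e1: "h - ix c = ix c' \<longleftrightarrow> ix c + ix c' = h"
        "h - ix c + ix c' = h \<longleftrightarrow> ix c = ix c'" using ix by auto
      have e2: "ix c + ix c' \<noteq> h" if "c < k \<or> c' < k"
        using bounds[of c] bounds[of c'] bounds2[of c] bounds2[of c'] that c by linarith
      have e3: "ix c + ix c' = h \<longleftrightarrow> ix c = ix c' \<and> 2 * ix c = h" if "\<not> c < k" "\<not> c' < k"
        using bounds2[of c] bounds2[of c'] that c by linarith
      show ?thesis
        unfolding fold_entry_def e1
        by (cases "c < k"; cases "c' < k")
          (use e2 e3 inj in \<open>auto simp: sg_def w_def\<close>)
    qed
    finally show "(P * G) $$ (c, c') = 1\<^sub>m (k + l) $$ (c, c')" using c by simp
  qed (auto simp: P_def G_def)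
  moreover have "P \<in> carrier_mat (k + l) (k + l)" "G \<in> carrier_mat (k + l) (k + l)" by (auto simp: P_def G_def)
  ultimately show ?thesis
    using carr TG DG unfolding k_def[symmetric] l_def[symmetric]
    by (intro pair_similarI[where m = "k + l" and Q = G and P = P]) (auto simp: blockdiag_def)
qed

text \<open>Since \<open>bdiag x i - bdiag x j\<close> is (j - i)(x - i - j), distinct eigenvalues
  mean that x avoids the sums i + j < 2d; the half-integers are the other zeros of the
  superdiagonal. The correction may only keep or double the last superdiagonal entry.\<close>

lemma tri_mat_irreducible:
  assumes x: "\<And>j. j < 2 * d \<Longrightarrow> x \<noteq> of_nat j" "\<And>i. i < d \<Longrightarrow> x \<noteq> of_nat i + 1/2"
    and \<kappa>: "\<And>i. Suc i = d \<Longrightarrow> \<kappa> i = 0 \<or> \<kappa> i = tri x i (Suc i)"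
  shows "rep_irreducible (d + 1) (rep_of (d + 1) \<delta> (tri_mat x d \<kappa>) (bdiag_mat x d))"
proof (rule rep_irreducible_tridiagonal[OF pair_carriers(2) pair_carriers(3), where t = "bdiag x"])
  show "bdiag x i \<noteq> bdiag x j" if "i < j" "j < d + 1" for i j
  proof
    assume "bdiag x i = bdiag x j"
    moreover have "bdiag x i - bdiag x j = (of_nat j - of_nat i) * (x - of_nat (i + j))"
      by (simp add: bdiag_def power2_eq_square field_simps)
    ultimately have "(of_nat j - of_nat i) * (x - of_nat (i + j)) = 0" by simp
    then show False using x(1)[of "i + j"] that by simp
  qed
  show "tri_mat x d \<kappa> $$ (Suc i, i) \<noteq> 0" if "Suc i < d + 1" for i
  proof -
    have "(of_nat i + 1/2 :: complex) = of_nat (2 * i + 1) / 2" by (simp add: field_simps)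
    also have "\<dots> \<noteq> 0" unfolding divide_eq_0_iff of_nat_eq_0_iff by simp
    finally have "(of_nat i + 1/2 :: complex) \<noteq> 0" .
    moreover have "(of_nat i + 1 :: complex) \<noteq> 0" using of_nat_neq_0[of i] by (simp add: add.commute)
    ultimately show ?thesis using that by (simp add: tri_mat_def tri_def)
  qed
  show "tri_mat x d \<kappa> $$ (i, Suc i) \<noteq> 0" if "Suc i < d + 1" for i
  proof -
    have "x - of_nat i \<noteq> 0" "x - of_nat i - 1/2 \<noteq> 0"
      using x(1)[of i] x(2)[of i] that by (auto simp: diff_diff_eq)
    then have "tri x i (Suc i) \<noteq> 0" by (simp add: tri_def)
    then show ?thesis using that \<kappa>[of i] by (auto simp: tri_mat_def)
  qed
qed (auto simp: bdiag_mat_def)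

lemma R_rep_eq:
  assumes a: "a + of_nat d / 2 = (if s then x / 2 - 1/2 else x / 2 - 1)"
    and b: "b + of_nat d / 2 = x / 2 - 1/2"
    and phi: "\<And>j. R_phi d a b c j = phi s x j"
    and \<delta>: "Rdelta d a b c = (x\<^sup>2 + x - 3) / 4"
  shows "R_rep d a b c = rep_of (d + 1) ((x\<^sup>2 + x - 3) / 4) (low_mat s x d) (upp_mat s x d)"
proof -
  have A: "R_A d a = low_mat s x d"
    unfolding R_A_def low_mat_def a
    by (rule eq_matI) (auto simp: adiag_def power2_eq_square field_simps)
  have B: "R_B d a b c = upp_mat s x d"
    unfolding R_B_def upp_mat_def b phi
    by (rule eq_matI) (auto simp: bdiag_def power2_eq_square field_simps)
  show ?thesis unfolding R_rep_def rep_of_def Let_def A B \<delta> ..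
qed

section \<open>Column d + 1 at the four kinds of cut-off\<close>

lemma coef_factor_zero:
  assumes "pochhammer (of_nat i + 1/2 - x) p = 0 \<or> poch_tail s (2 * of_nat i - x) p = 0"
  shows "coef s x i p = 0"
  using assms by (auto simp: coef_def)

text \<open>The bounds on k differ because the Pochhammer product has p - 1 factors in the family
  True and p factors in the family False.\<close>

lemma poch_tail_eq_0:
  assumes "y + of_nat p + 1 = - of_nat k" "if s then k + 1 < p else k < p"
  shows "poch_tail s y p = 0"
  using assms pochhammer_of_nat_eq_0_lemma[of k p, where ?'a = complex]
    pochhammer_of_nat_eq_0_lemma[of k "p - 1", where ?'a = complex]
  unfolding poch_tail_def assms(1) by (auto split: if_splits)

lemma upper_entry_boundary_half:
  assumes "x = of_nat d + 1/2" "i \<le> d"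
  shows "upper_entry s x i (d + 1) = 0"
proof -
  have y: "of_nat i + 1/2 - x = - of_nat (d - i)" using assms by (simp add: of_nat_diff)
  have "pochhammer (of_nat i + 1/2 - x) (d + 1 - i) = 0"
    unfolding y by (rule pochhammer_of_nat_eq_0_lemma) (use assms in simp)
  then show ?thesis using assms by (simp add: upper_entry_def coef_factor_zero)
qed

lemma upper_entry_boundary_minus_even:
  assumes "x = 2 * of_nat d + 2" "i \<le> d"
  shows "upper_entry False x i (d + 1) = 0"
proof -
  have "2 * of_nat i - x + of_nat (d + 1 - i) + 1 = - of_nat (d - i)" using assms by (simp add: of_nat_diff)
  then have "poch_tail False (2 * of_nat i - x) (d + 1 - i) = 0"
    by (rule poch_tail_eq_0) (use assms in simp)
  then show ?thesis using assms by (simp add: upper_entry_def coef_factor_zero)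
qed

lemma upper_entry_boundary_odd:
  assumes x: "x = 2 * of_nat d + 1" and i: "i < d"
  shows "upper_entry s x i (d + 1) = 0"
proof -
  have "2 * of_nat i - x + of_nat (d + 1 - i) + 1 = - of_nat (d - i - 1)" using assms by (simp add: of_nat_diff)
  then have "poch_tail s (2 * of_nat i - x) (d + 1 - i) = 0"
    by (rule poch_tail_eq_0) (use i in auto)
  then show ?thesis using assms by (simp add: upper_entry_def coef_factor_zero)
qed

text \<open>Here B has equal eigenvalues at d and d + 1, mirror images of each other, and the
  surviving entry needs the reflected coefficient with the sign of the eigenspace.\<close>

lemma upper_entry_boundary_odd_last:
  assumes x: "x = 2 * of_nat d + 1"
  shows "(if s then 1 else - 1) * tri x (d + 1) d * coef s x d 0 + upper_entry s x d (d + 1) = 0"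
  unfolding x by (simp add: upper_entry_def coef_def poch_tail_def tri_def field_simps)

text \<open>For i = d the prefactor y of \<open>poch_tail\<close> is zero; for i + 2 \<le> d the
  Pochhammer product runs through zero. At i + 1 = d neither happens.\<close>

lemma upper_entry_boundary_plus_even:
  assumes x: "x = 2 * of_nat d" and i: "i \<le> d" "i + 1 \<noteq> d"
  shows "upper_entry True x i (d + 1) = 0"
proof (cases "i = d")
  case True
  then show ?thesis using x by (simp add: upper_entry_def coef_def poch_tail_def)
next
  case False
  have "2 * of_nat i - x + of_nat (d + 1 - i) + 1 = - of_nat (d - i - 2)"
    using assms False by (simp add: of_nat_diff)
  then have "poch_tail True (2 * of_nat i - x) (d + 1 - i) = 0"
    by (rule poch_tail_eq_0) (use i False in auto)
  then show ?thesis using assms by (simp add: upper_entry_def coef_factor_zero)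
qed

text \<open>The mirror image of d + 1 is now d - 1, so the correction sits on the
  superdiagonal.\<close>

lemma upper_entry_boundary_plus_even_last:
  assumes x: "x = 2 * of_nat d" and d: "d = Suc i"
  shows "tri x (d + 1) d * coef True x d 0 + upper_entry True x i (d + 1) = 0"
  unfolding x d
  by (simp add: upper_entry_def coef_def poch_tail_def tri_def pochhammer_Suc pochhammer_rec
      numeral_2_eq_2 field_simps)

section \<open>Assembling the summands\<close>

lemma of_nat_neq_half: "of_nat a \<noteq> (of_nat b + 1/2 :: complex)"
proof
  assume "of_nat a = (of_nat b + 1/2 :: complex)"
  then have "of_nat (2 * a) = (of_nat (2 * b + 1) :: complex)" by (simp add: field_simps)
  then have "2 * a = 2 * b + 1" by (simp only: of_nat_eq_iff)
  then show False by presburger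
qed

text \<open>Reduces even n to data about \<kappa>: \<open>fold\<close> says that it describes the
  folded action, \<open>last1\<close> and \<open>last2\<close> that it repairs the cut-off,
  \<open>sup1\<close> and \<open>sup2\<close> that irreducibility survives it.\<close>

lemma even_decomposition:
  fixes h d1 d2 :: nat and \<kappa> :: "complex \<Rightarrow> nat \<Rightarrow> complex"
  defines "x \<equiv> of_nat h"
  defines "d e \<equiv> (if e = (1 :: complex) then d2 else d1)"
  assumes h: "d1 + d2 + 1 = h" "2 * d1 + 1 \<le> h" "2 * d2 \<le> h"
    and fold: "\<And>e i c. e \<in> {-1, 1} \<Longrightarrow> i \<le> h \<Longrightarrow> c \<le> d e \<Longrightarrow>
      tri x i c + e * tri x (h - i) c
      = (if i \<le> d e then tri x i c + (if c = d e then \<kappa> e i else 0) else 0)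
        + e * (if h - i \<le> d e then tri x (h - i) c + (if c = d e then \<kappa> e (h - i) else 0) else 0)"
    and last1: "\<And>i. i \<le> d1 \<Longrightarrow> \<kappa> (-1) i * coef False x d1 0 + upper_entry False x i (d1 + 1) = 0"
    and last2: "\<And>i. i \<le> d2 \<Longrightarrow> \<kappa> 1 i * coef True x d2 0 + upper_entry True x i (d2 + 1) = 0"
    and sup1: "\<And>i. Suc i = d1 \<Longrightarrow> \<kappa> (-1) i = 0 \<or> \<kappa> (-1) i = tri x i (Suc i)"
    and sup2: "\<And>i. Suc i = d2 \<Longrightarrow> \<kappa> 1 i = 0 \<or> \<kappa> 1 i = tri x i (Suc i)"
    and R1: "R1 = rep_of (d1 + 1) ((x\<^sup>2 + x - 3) / 4) (low_mat False x d1) (upp_mat False x d1)"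
    and R2: "R2 = rep_of (d2 + 1) ((x\<^sup>2 + x - 3) / 4) (low_mat True x d2) (upp_mat True x d2)"
  shows "rep_irreducible (d1 + 1) R1 \<and> rep_irreducible (d2 + 1) R2 \<and>
    rep_iso (even_dim (2 * h)) (L0_rep (2 * h)) (rep_sum (d1 + 1) (d2 + 1) R1 R2)"
proof -
  have sim1: "pair_similar (tri_mat x d1 (\<kappa> (-1))) (bdiag_mat x d1) (low_mat False x d1) (upp_mat False x d1)"
    by (rule tri_mat_similar[OF last1])
  have sim2: "pair_similar (tri_mat x d2 (\<kappa> 1)) (bdiag_mat x d2) (low_mat True x d2) (upp_mat True x d2)"
    by (rule tri_mat_similar[OF last2])
  have "rep_irreducible (d1 + 1) R1" unfolding R1
    by (rule rep_irreducible_similar[OF tri_mat_irreducible sim1])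
      (use h sup1 of_nat_neq_half in \<open>auto simp: x_def\<close>)
  moreover have "rep_irreducible (d2 + 1) R2" unfolding R2
    by (rule rep_irreducible_similar[OF tri_mat_irreducible sim2])
      (use h sup2 of_nat_neq_half in \<open>auto simp: x_def\<close>)
  moreover have "rep_iso (even_dim (2 * h)) (L0_rep (2 * h)) (rep_sum (d1 + 1) (d2 + 1) R1 R2)"
  proof -
    have "pair_similar (tri_mat x h (\<lambda>_. 0)) (bdiag_mat x h)
      (blockdiag (d1 + 1) (d2 + 1) (tri_mat x d1 (\<kappa> (-1))) (tri_mat x d2 (\<kappa> 1)))
      (blockdiag (d1 + 1) (d2 + 1) (bdiag_mat x d1) (bdiag_mat x d2))"
      unfolding x_def by (rule fold_similar[OF h]) (use fold in \<open>simp add: d_def x_def\<close>)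
    from pair_similar_trans[OF this pair_similar_blockdiag[OF sim1 sim2 pair_carriers(2,3,2,3)]]
    have "rep_iso (h + 1) (rep_of (h + 1) ((x\<^sup>2 + x - 3) / 4) (tri_mat x h (\<lambda>_. 0)) (bdiag_mat x h))
      (rep_of (h + 1) ((x\<^sup>2 + x - 3) / 4)
        (blockdiag (d1 + 1) (d2 + 1) (low_mat False x d1) (low_mat True x d2))
        (blockdiag (d1 + 1) (d2 + 1) (upp_mat False x d1) (upp_mat True x d2)))"
      by (rule rep_iso_rep_of[OF _ pair_carriers(2,3)])
    moreover have "h + 1 = (d1 + 1) + (d2 + 1)" using h by simp
    moreover have "L0_rep (2 * h) = rep_of (h + 1) ((x\<^sup>2 + x - 3) / 4) (tri_mat x h (\<lambda>_. 0)) (bdiag_mat x h)"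
      using L0_rep_eq[of "2 * h"] by (simp add: x_def)
    ultimately show ?thesis
      unfolding R1 R2 rep_sum_rep_of[OF pair_carriers(4,5,4,5)] by (simp add: even_dim_def)
  qed
  ultimately show ?thesis by blast
qed

text \<open>Serves odd n, where the involution exchanges even and odd indices and so does not act on
  L_n^(0), and n = 0, where it is the identity.\<close>

lemma unfolded_decomposition:
  fixes n d :: nat
  defines "x \<equiv> of_nat n / 2"
  assumes d: "d = n div 2" and last: "\<And>i. i \<le> d \<Longrightarrow> upper_entry True x i (d + 1) = 0"
    and x: "\<And>j. j < 2 * d \<Longrightarrow> x \<noteq> of_nat j" "\<And>i. i < d \<Longrightarrow> x \<noteq> of_nat i + 1/2"
    and R: "R = rep_of (d + 1) ((x\<^sup>2 + x - 3) / 4) (low_mat True x d) (upp_mat True x d)"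
  shows "rep_irreducible (d + 1) R \<and> rep_iso (even_dim n) (L0_rep n) R"
proof -
  have sim: "pair_similar (tri_mat x d (\<lambda>_. 0)) (bdiag_mat x d) (low_mat True x d) (upp_mat True x d)"
    by (rule tri_mat_similar) (use last in simp)
  have "rep_irreducible (d + 1) R" unfolding R
    by (rule rep_irreducible_similar[OF tri_mat_irreducible[OF x] sim]) auto
  moreover have "rep_iso (even_dim n) (L0_rep n) R"
    unfolding R L0_rep_eq even_dim_def x_def[symmetric] d[symmetric]
    by (rule rep_iso_rep_of[OF sim pair_carriers(2,3)])
  ultimately show ?thesis ..
qed

lemma decomposition_0_mod_4:
  fixes k :: nat
  defines "x \<equiv> of_nat (2 * k + 2)"
  assumes R1: "R1 = rep_of (k + 1) ((x\<^sup>2 + x - 3) / 4) (low_mat False x k) (upp_mat False x k)"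
    and R2: "R2 = rep_of (k + 1 + 1) ((x\<^sup>2 + x - 3) / 4) (low_mat True x (k + 1)) (upp_mat True x (k + 1))"
  shows "rep_irreducible (k + 1) R1 \<and> rep_irreducible (k + 1 + 1) R2 \<and>
    rep_iso (even_dim (2 * (2 * k + 2))) (L0_rep (2 * (2 * k + 2))) (rep_sum (k + 1) (k + 1 + 1) R1 R2)"
proof -
  \<comment> \<open>The middle symmetric vector is 2 v at index k + 1. Its image meets both mirror
    indices k and k + 2 equally, which doubles the entry in row k; antisymmetric vectors vanish at
    the middle and need no correction.\<close>
  define \<kappa> :: "complex \<Rightarrow> nat \<Rightarrow> complex"
    where "\<kappa> e i = (if e = 1 \<and> i = k then tri x (k + 2) (k + 1) else 0)" for e i
  have x: "x = 2 * of_nat k + 2" "x = 2 * of_nat (k + 1)" by (auto simp: x_def)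
  show ?thesis
  proof (rule even_decomposition[where \<kappa> = \<kappa> and h = "2 * k + 2", folded x_def,
        OF _ _ _ _ _ _ _ _ R1 R2])
    fix e :: complex and i c
    assume e: "e \<in> {-1, 1}" and i: "i \<le> 2 * k + 2" and c: "c \<le> (if e = 1 then k + 1 else k)"
    let ?d = "if e = 1 then k + 1 else k" and ?h = "2 * k + 2"
    have far: "tri x (?h - i) c = 0" if "i < k \<or> (i = k \<and> c \<le> k)"
      by (rule tri_far) (use that c in \<open>auto split: if_splits\<close>)
    have far': "tri x i c = 0" if "i > k + 2 \<or> (i = k + 2 \<and> c \<le> k)"
      by (rule tri_far) (use that c in \<open>auto split: if_splits\<close>)
    \<comment> \<open>Away from the three central rows one of i and its mirror image is too far from
      column c for \<open>tri\<close> to be nonzero.\<close>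
    consider "i < k" | "i = k" | "i = k + 1" | "i = k + 2" | "i > k + 2" by linarith
    then show "tri x i c + e * tri x (?h - i) c
      = (if i \<le> ?d then tri x i c + (if c = ?d then \<kappa> e i else 0) else 0)
        + e * (if ?h - i \<le> ?d then tri x (?h - i) c + (if c = ?d then \<kappa> e (?h - i) else 0) else 0)"
    proof cases
      case 1
      then show ?thesis using far i by (auto simp: \<kappa>_def)
    next
      case 2
      then show ?thesis using far i e c
        by (cases "e = 1"; cases "c = k + 1") (auto simp: \<kappa>_def Suc_diff_le)
    next
      case 3
      then show ?thesis using e by (auto simp: \<kappa>_def)
    next
      case 4
      then show ?thesis using far' i e c
        by (cases "e = 1"; cases "c = k + 1") (auto simp: \<kappa>_def)
    next
      case 5
      then have "?h - i < k" using i by auto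
      then show ?thesis using 5 far' i by (auto simp: \<kappa>_def)
    qed
  next
    show "\<kappa> 1 i * coef True x (k + 1) 0 + upper_entry True x i (k + 1 + 1) = 0" if "i \<le> k + 1" for i
      using upper_entry_boundary_plus_even[OF x(2), of i] upper_entry_boundary_plus_even_last[OF x(2), of i] that
      by (cases "i = k") (simp_all add: \<kappa>_def)
    show "\<kappa> (-1) i * coef False x k 0 + upper_entry False x i (k + 1) = 0" if "i \<le> k" for i
      using upper_entry_boundary_minus_even[OF x(1) that] by (simp add: \<kappa>_def)
    show "\<kappa> 1 i = 0 \<or> \<kappa> 1 i = tri x i (Suc i)" if "Suc i = k + 1" for i
      using that by (simp add: \<kappa>_def tri_def x(1) field_simps)
  qed (auto simp: \<kappa>_def)
qed

lemma decomposition_2_mod_4: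
  fixes m :: nat
  defines "x \<equiv> of_nat (2 * m + 1)"
  assumes R1: "R1 = rep_of (m + 1) ((x\<^sup>2 + x - 3) / 4) (low_mat False x m) (upp_mat False x m)"
    and R2: "R2 = rep_of (m + 1) ((x\<^sup>2 + x - 3) / 4) (low_mat True x m) (upp_mat True x m)"
  shows "rep_irreducible (m + 1) R1 \<and> rep_irreducible (m + 1) R2 \<and>
    rep_iso (even_dim (2 * (2 * m + 1))) (L0_rep (2 * (2 * m + 1))) (rep_sum (m + 1) (m + 1) R1 R2)"
proof -
  \<comment> \<open>There is no middle index. A sends v_m partly to v_{m+1}, which is the mirror of
    v_m and hence returns to the last diagonal entry with sign e.\<close>
  define \<kappa> :: "complex \<Rightarrow> nat \<Rightarrow> complex"
    where "\<kappa> e i = (if i = m then e * tri x (m + 1) m else 0)" for e i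
  have x: "x = 2 * of_nat m + 1" by (simp add: x_def)
  show ?thesis
  proof (rule even_decomposition[where \<kappa> = \<kappa> and h = "2 * m + 1", folded x_def,
        OF _ _ _ _ _ _ _ _ R1 R2])
    fix e :: complex and i c
    assume e: "e \<in> {-1, 1}" and i: "i \<le> 2 * m + 1" and "c \<le> (if e = 1 then m else m)"
    let ?h = "2 * m + 1"
    have c: "c \<le> m" using \<open>c \<le> (if e = 1 then m else m)\<close> by simp
    have far: "tri x (?h - i) c = 0" if "i < m \<or> (i = m \<and> c < m)"
      by (rule tri_far) (use that c in auto)
    have far': "tri x i c = 0" if "i > m + 1 \<or> (i = m + 1 \<and> c < m)"
      by (rule tri_far) (use that c in auto)
    consider "i < m" | "i = m" | "i = m + 1" | "i > m + 1" by linarith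
    then show "tri x i c + e * tri x (?h - i) c
      = (if i \<le> (if e = 1 then m else m) 
         then tri x i c + (if c = (if e = 1 then m else m) then \<kappa> e i else 0) else 0)
        + e * (if ?h - i \<le> (if e = 1 then m else m)
         then tri x (?h - i) c + (if c = (if e = 1 then m else m) then \<kappa> e (?h - i) else 0) else 0)"
    proof cases
      case 1
      then show ?thesis using far i by (auto simp: \<kappa>_def)
    next
      case 2
      then show ?thesis using far c by (cases "c = m") (auto simp: \<kappa>_def)
    next
      case 3
      then show ?thesis using far' c e by (cases "c = m") (auto simp: \<kappa>_def)
    next
      case 4
      then have "?h - i < m" using i by auto
      then show ?thesis using 4 far' i by (auto simp: \<kappa>_def)
    qed
  next
    show "\<kappa> 1 i * coef True x m 0 + upper_entry True x i (m + 1) = 0" if "i \<le> m" for i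
      using upper_entry_boundary_odd[OF x, of i True] upper_entry_boundary_odd_last[OF x, of True] that
      by (cases "i = m") (simp_all add: \<kappa>_def)
    show "\<kappa> (-1) i * coef False x m 0 + upper_entry False x i (m + 1) = 0" if "i \<le> m" for i
      using upper_entry_boundary_odd[OF x, of i False] upper_entry_boundary_odd_last[OF x, of False] that
      by (cases "i = m") (simp_all add: \<kappa>_def)
  qed (auto simp: \<kappa>_def)
qed

section \<open>Matching the parameters of the target modules\<close>

theorem theorem7p3:
  fixes n :: nat
  shows
   "(odd n \<longrightarrow>
       rep_irreducible ((n - 1) div 2 + 1) (R_rep ((n - 1) div 2) (-1/4) (-1/4) (-1/4)) \<and>
       rep_iso (even_dim n) (L0_rep n) (R_rep ((n - 1) div 2) (-1/4) (-1/4) (-1/4)))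
  \<and> (n = 0 \<longrightarrow>
       rep_irreducible 1 (R_rep 0 (-1/2) (-1/2) (-1/2)) \<and>
       rep_iso (even_dim n) (L0_rep n) (R_rep 0 (-1/2) (-1/2) (-1/2)))
  \<and> (n \<noteq> 0 \<and> n mod 4 = 0 \<longrightarrow>
       (let k = n div 4 - 1; l = n div 4;
            R1 = R_rep k ((of_nat n - 4) / 8) (of_nat n / 8) ((of_nat n - 4) / 8);
            R2 = R_rep l ((of_nat n - 4) / 8) ((of_nat n - 4) / 8) ((of_nat n - 4) / 8)
        in rep_irreducible (k + 1) R1 \<and> rep_irreducible (l + 1) R2 \<and>
           rep_iso (even_dim n) (L0_rep n) (rep_sum (k + 1) (l + 1) R1 R2)))
  \<and> (n mod 4 = 2 \<longrightarrow>
       (let k = (n - 2) div 4;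
            R1 = R_rep k ((of_nat n - 6) / 8) ((of_nat n - 2) / 8) ((of_nat n - 2) / 8);
            R2 = R_rep k ((of_nat n - 2) / 8) ((of_nat n - 2) / 8) ((of_nat n - 6) / 8)
        in rep_irreducible (k + 1) R1 \<and> rep_irreducible (k + 1) R2 \<and>
           rep_iso (even_dim n) (L0_rep n) (rep_sum (k + 1) (k + 1) R1 R2)))"
proof (intro conjI impI)
  assume "odd n"
  then obtain d where n: "n = 2 * d + 1" by (rule oddE)
  define x :: complex where "x = of_nat n / 2"
  have x: "x = of_nat d + 1/2" by (simp add: x_def n field_simps)
  have "R_rep d (-1/4) (-1/4) (-1/4)
      = rep_of (d + 1) ((x\<^sup>2 + x - 3) / 4) (low_mat True x d) (upp_mat True x d)"
    by (rule R_rep_eq) (simp_all add: x R_phi_def phi_def Rdelta_def power2_eq_square field_simps)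
  moreover have "x \<noteq> of_nat j" for j using of_nat_neq_half[of j d] x by auto
  ultimately have "rep_irreducible (d + 1) (R_rep d (-1/4) (-1/4) (-1/4)) \<and>
      rep_iso (even_dim n) (L0_rep n) (R_rep d (-1/4) (-1/4) (-1/4))"
    by (intro unfolded_decomposition[where n = n, folded x_def] upper_entry_boundary_half[OF x])
      (auto simp: n x)
  then show "rep_irreducible ((n - 1) div 2 + 1) (R_rep ((n - 1) div 2) (-1/4) (-1/4) (-1/4))"
    "rep_iso (even_dim n) (L0_rep n) (R_rep ((n - 1) div 2) (-1/4) (-1/4) (-1/4))"
    by (simp_all add: n)
next
  assume n: "n = 0"
  \<comment> \<open>The value -1/2 is (n - 4)/8 at n = 0: of the two summands for n divisible by 4
    only the symmetric one remains.\<close>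
  have "R_rep 0 (-1/2) (-1/2) (-1/2)
      = rep_of (0 + 1) ((0\<^sup>2 + 0 - 3) / 4) (low_mat True 0 0) (upp_mat True 0 0)"
    by (rule R_rep_eq) (simp_all add: R_phi_def phi_def Rdelta_def power2_eq_square field_simps)
  then have "rep_irreducible (0 + 1) (R_rep 0 (-1/2) (-1/2) (-1/2)) \<and>
      rep_iso (even_dim n) (L0_rep n) (R_rep 0 (-1/2) (-1/2) (-1/2))"
    by (intro unfolded_decomposition) (auto simp: n upper_entry_def coef_def poch_tail_def)
  then show "rep_irreducible 1 (R_rep 0 (-1/2) (-1/2) (-1/2))"
    "rep_iso (even_dim n) (L0_rep n) (R_rep 0 (-1/2) (-1/2) (-1/2))"
    by simp_all
next
  assume "n \<noteq> 0 \<and> n mod 4 = 0"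
  then have "n = 2 * (2 * (n div 4 - 1) + 2)" by presburger
  then obtain k where n: "n = 2 * (2 * k + 2)" by blast
  define x :: complex where "x = of_nat (2 * k + 2)"
  have x: "x = 2 * of_nat k + 2" by (simp add: x_def)
  have n': "of_nat n = 2 * x" by (simp add: n x)
  have div: "n div 4 = k + 1" by (simp add: n)
  have R1: "R_rep k ((of_nat n - 4) / 8) (of_nat n / 8) ((of_nat n - 4) / 8)
      = rep_of (k + 1) ((x\<^sup>2 + x - 3) / 4) (low_mat False x k) (upp_mat False x k)"
    by (rule R_rep_eq) (simp_all add: n' x R_phi_def phi_def Rdelta_def power2_eq_square field_simps)
  have R2: "R_rep (k + 1) ((of_nat n - 4) / 8) ((of_nat n - 4) / 8) ((of_nat n - 4) / 8)
      = rep_of (k + 1 + 1) ((x\<^sup>2 + x - 3) / 4) (low_mat True x (k + 1)) (upp_mat True x (k + 1))"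
    by (rule R_rep_eq) (simp_all add: n' x R_phi_def phi_def Rdelta_def power2_eq_square field_simps)
  show "let k = n div 4 - 1; l = n div 4;
            R1 = R_rep k ((of_nat n - 4) / 8) (of_nat n / 8) ((of_nat n - 4) / 8);
            R2 = R_rep l ((of_nat n - 4) / 8) ((of_nat n - 4) / 8) ((of_nat n - 4) / 8)
        in rep_irreducible (k + 1) R1 \<and> rep_irreducible (l + 1) R2 \<and>
           rep_iso (even_dim n) (L0_rep n) (rep_sum (k + 1) (l + 1) R1 R2)"
    unfolding Let_def div add_diff_cancel_right'
    using decomposition_0_mod_4[OF R1[unfolded x_def] R2[unfolded x_def]] unfolding n[symmetric] .
next
  assume "n mod 4 = 2"
  then have "n = 2 * (2 * (n div 4) + 1)" by presburger
  then obtain m where n: "n = 2 * (2 * m + 1)" by blast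
  define x :: complex where "x = of_nat (2 * m + 1)"
  have x: "x = 2 * of_nat m + 1" by (simp add: x_def)
  have n': "of_nat n = 2 * x" by (simp add: n x)
  have div: "(n - 2) div 4 = m" by (simp add: n)
  have R1: "R_rep m ((of_nat n - 6) / 8) ((of_nat n - 2) / 8) ((of_nat n - 2) / 8)
      = rep_of (m + 1) ((x\<^sup>2 + x - 3) / 4) (low_mat False x m) (upp_mat False x m)"
    by (rule R_rep_eq) (simp_all add: n' x R_phi_def phi_def Rdelta_def power2_eq_square field_simps)
  have R2: "R_rep m ((of_nat n - 2) / 8) ((of_nat n - 2) / 8) ((of_nat n - 6) / 8)
      = rep_of (m + 1) ((x\<^sup>2 + x - 3) / 4) (low_mat True x m) (upp_mat True x m)"
    by (rule R_rep_eq) (simp_all add: n' x R_phi_def phi_def Rdelta_def power2_eq_square field_simps)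
  show "let k = (n - 2) div 4;
            R1 = R_rep k ((of_nat n - 6) / 8) ((of_nat n - 2) / 8) ((of_nat n - 2) / 8);
            R2 = R_rep k ((of_nat n - 2) / 8) ((of_nat n - 2) / 8) ((of_nat n - 6) / 8)
        in rep_irreducible (k + 1) R1 \<and> rep_irreducible (k + 1) R2 \<and>
           rep_iso (even_dim n) (L0_rep n) (rep_sum (k + 1) (k + 1) R1 R2)"
    unfolding Let_def div
    using decomposition_2_mod_4[OF R1[unfolded x_def] R2[unfolded x_def]] unfolding n[symmetric] .
qed

end
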